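(* Assume that Connes' embedding conjecture holds. Then for every graph $G$, $\widetilde\chi_q(G)\le\inf_{\epsilon>0}\Psi_\epsilon(G)$.
   Context: Graphs are finite, undirected, without loops, with at least one vertex; $[t]=\{1,\dots,t\}$. $\mathcal S^d$ denotes the real symmetric $d\times d$ matrices with trace inner product $\langle X,Y\rangle=\mathrm{Tr}(XY)$, and $\mathcal S^d_+$ the positive semidefinite ones. $\mathcal{CS}_+^m$ is the set of $A\in\mathcal S^m$ for which there exist $d\ge1$ and $X_1,\dots,X_m\in\mathcal S^d_+$ with $A_{ij}=\langle X_i,X_j\rangle$ for all $i,j$; $\mathrm{cl}$ denotes closure. Notation. Let $n=|V(G)|$ and $N=\sum_{t=1}^n(nt+1)$. View $\mathcal S^N$ as block matrices with $n$ diagonal blocks, the $t$-th block being indexed by $\{0\}\cup(V(G)\times[t])$ ($ui$ abbreviates $(u,i)$). For $u\in V(G)$, $A_u^t\in\mathcal S^{nt+1}$ has entries $A_u^t(0,0)=A_u^t(ui,uj)=1$ for $i,j\in[t]$, $A_u^t(0,ui)=A_u^t(ui,0)=-1$ for $i\in[t]$, zero elsewhere; $A^t=\sum_{u}A_u^t$ and $A=\bigoplus_{t=1}^nA^t$. Let $E^t_{a,b}\in\mathcal S^{nt+1}$ be the elementary symmetric matrices (supported at positions $(a,b)$ and $(b,a)$), and $\widetilde E^t_{a,b}\in\mathcal S^N$ their extension by zeros outside the $t$-th block. Let $C=\bigoplus_{t=1}^nt\,E^t_{0,0}$ and $B=\bigoplus_{t=1}^nE^t_{0,0}$. $\widetilde\chi_q(G)$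 is the optimal value of: minimize $\langle C,X\rangle$ over $X\in\mathrm{cl}(\mathcal{CS}_+^N)$ subject to $\langle B,X\rangle=1$, $\langle A,X\rangle=0$, $\langle\widetilde E^t_{ui,vi},X\rangle=0$ for all $t\in[n]$, $i\in[t]$, $\{u,v\}\in E(G)$, and $\langle\widetilde E^t_{ui,uj},X\rangle=0$ for all $t\in[n]$, $i\ne j\in[t]$, $u\in V(G)$. Sets $\mathcal K_{\mathrm{nc},\epsilon}$. $\mathbb R\langle\underline X\rangle$ is the ring of real polynomials in non-commutative variables $X_1,\dots,X_N$, with the linear involution $*$ fixing each variable and reversing each monomial; $f$ is symmetric if $f^*=f$. A commutator is $[f,g]=fg-gf$. $\mathrm{tr}\mathcal M^{\mathrm{ball}}_{\mathrm{nc}}$ is the set of polynomials $h+\sum_{j=1}^{m_0}f_jf_j^*+\sum_{j=1}^{m_1}g_j(1-\sum_{i=1}^NX_i^2)g_j^*$ with $h$ a sum of commutators, $f_j,g_j\in\mathbb R\langle\underline X\rangle$, $m_0,m_1\in\mathbb N$. For $M\in\mathcal S^N$, $p_M=\sum_{i,j=1}^NM_{ij}X_i^2X_j^2$, and $\mathcal K_{\mathrm{nc},\epsilon}=\{M\in\mathcal S^N:p_M+\epsilon\in\mathrm{tr}\mathcal M^{\mathrm{ball}}_{\mathrm{nc}}\}$. $\Psi_\epsilon(G)$ is the supremum of $\lambda$ over all real $\lambda,\mu,y^t_{u,v,i},z^t_{u,i,j}$ such that $C-\lambda B-\mu A-\sum y^t_{u,v,i}\widetilde E^t_{ui,vi}-\sum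 z^t_{u,i,j}\widetilde E^t_{ui,uj}\in\mathcal K_{\mathrm{nc},\epsilon}$, where the first sum is over $t\in[n]$, $i\in[t]$, $\{u,v\}\in E(G)$ and the second over $t\in[n]$, $i\ne j\in[t]$, $u\in V(G)$. Connes' embedding conjecture: every separable II$_1$ factor embeds (trace-preservingly) into an ultrapower $\mathcal R^\omega$ of the hyperfinite II$_1$ factor $\mathcal R$. It is used in the following form, known (Klep–Schweighofer, Burgdorf et al.) to be equivalent to it: for every number $N$ of variables and every symmetric $f\in\mathbb R\langle\underline X\rangle$, one has $\mathrm{Tr}(f(X_1,\dots,X_N))\ge0$ for all $d\ge1$ and all $(X_1,\dots,X_N)\in(\mathcal S^d)^N$ with $I-\sum_{i=1}^NX_i^2\succeq0$ if and only if $f+\epsilon\in\mathrm{tr}\mathcal M^{\mathrm{ball}}_{\mathrm{nc}}$ for all $\epsilon>0$. *)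

theory Defs
  imports
    "HOL-Analysis.Function_Topology"
    "HOL-Library.Extended_Real"
    "HOL-Library.Poly_Mapping"
    "Jordan_Normal_Form.Matrix"
    "Graph_Theory.Digraph"
begin

section \<open>Real symmetric and positive semidefinite matrices of variable size\<close>

definition mat_trace :: "real mat \<Rightarrow> real" where
  "mat_trace A = (\<Sum>i<dim_row A. A $$ (i, i))"

definition sym_mats :: "nat \<Rightarrow> real mat set" where
  "sym_mats d = {A \<in> carrier_mat d d. transpose_mat A = A}"

definition psd_mats :: "nat \<Rightarrow> real mat set" where
  "psd_mats d = {A \<in> sym_mats d. \<forall>v \<in> carrier_vec d. scalar_prod v (mult_mat_vec A v) \<ge> 0}"

section \<open>Symmetric matrices indexed by a finite set and the completely positive semidefinite cone\<close>

text \<open>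
  A real matrix whose rows and columns are indexed by a finite set \<open>I\<close> is a function of two
  arguments that vanishes outside \<open>I \<times> I\<close>. The topology on these functions is the product
  topology, which on this finite-dimensional space is the Euclidean one, so \<^const>\<open>closure\<close> is the
  usual closure.
\<close>

type_synonym 'i imat = "'i \<Rightarrow> 'i \<Rightarrow> real"

definition sym_imats :: "'i set \<Rightarrow> 'i imat set" where
  "sym_imats I = {M. (\<forall>p q. M p q = M q p) \<and> (\<forall>p q. p \<notin> I \<or> q \<notin> I \<longrightarrow> M p q = 0)}"

text \<open>The trace of the product of two matrices.\<close>

definition imat_inner :: "'i set \<Rightarrow> 'i imat \<Rightarrow> 'i imat \<Rightarrow> real" where
  "imat_inner I X Y = (\<Sum>p\<in>I. \<Sum>q\<in>I. X p q * Y q p)"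

definition cpsd :: "'i set \<Rightarrow> 'i imat set" where
  "cpsd I = {A \<in> sym_imats I. \<exists>d\<ge>1. \<exists>X. (\<forall>p\<in>I. X p \<in> psd_mats d) \<and>
     (\<forall>p\<in>I. \<forall>q\<in>I. A p q = mat_trace (X p * X q))}"

definition elem_sym :: "'i \<Rightarrow> 'i \<Rightarrow> 'i imat" where
  "elem_sym a b = (\<lambda>p q. if (p = a \<and> q = b) \<or> (p = b \<and> q = a) then 1 else 0)"

section \<open>Real polynomials in non-commutative variables\<close>

text \<open>
  Words form the free monoid, written additively so that \<^typ>\<open>'a \<Rightarrow>\<^sub>0 real\<close> over words, with its
  convolution product, is the free algebra. The variable set is carried by \<open>ncpolys I\<close>.
\<close>

datatype 'x ncword = NCWord (letters: "'x list")

instantiation ncword :: (type) monoid_add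
begin

definition zero_ncword :: "'a ncword" where
  "0 = NCWord []"

definition plus_ncword :: "'a ncword \<Rightarrow> 'a ncword \<Rightarrow> 'a ncword" where
  "v + w = NCWord (letters v @ letters w)"

instance
  by standard (simp_all add: zero_ncword_def plus_ncword_def)

end

type_synonym 'x ncpoly = "'x ncword \<Rightarrow>\<^sub>0 real"

definition ncpolys :: "'x set \<Rightarrow> 'x ncpoly set" where
  "ncpolys I = {f. \<forall>w \<in> Poly_Mapping.keys f. set (letters w) \<subseteq> I}"

definition nc_const :: "real \<Rightarrow> 'x ncpoly" where
  "nc_const c = Poly_Mapping.single 0 c"

definition nc_var :: "'x \<Rightarrow> 'x ncpoly" where
  "nc_var x = Poly_Mapping.single (NCWord [x]) 1"

definition rev_ncword :: "'x ncword \<Rightarrow> 'x ncword" where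
  "rev_ncword w = NCWord (rev (letters w))"

definition nc_star :: "'x ncpoly \<Rightarrow> 'x ncpoly" where
  "nc_star f = Poly_Mapping.map_key rev_ncword f"

text \<open>\<^const>\<open>Poly_Mapping.map_key\<close> is precomposition only for injective maps.\<close>

lemma inj_rev_ncword: "inj rev_ncword"
  by (auto simp: inj_def rev_ncword_def ncword.expand)

lemma lookup_nc_star: "Poly_Mapping.lookup (nc_star f) w = Poly_Mapping.lookup f (rev_ncword w)"
  by (simp add: nc_star_def map_key.rep_eq inj_rev_ncword)

definition nc_commutator_sums :: "'x set \<Rightarrow> 'x ncpoly set" where
  "nc_commutator_sums I = {\<Sum>j<k. a j * b j - b j * a j | (k :: nat) a b.
     \<forall>j<k. a j \<in> ncpolys I \<and> b j \<in> ncpolys I}"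

definition tr_ball_module :: "'x set \<Rightarrow> 'x ncpoly set" where
  "tr_ball_module I =
     {h + (\<Sum>j<m\<^sub>0. f j * nc_star (f j))
        + (\<Sum>j<m\<^sub>1. g j * (1 - (\<Sum>i\<in>I. nc_var i ^ 2)) * nc_star (g j)) | h (m\<^sub>0 :: nat) f (m\<^sub>1 :: nat) g.
      h \<in> nc_commutator_sums I \<and> (\<forall>j<m\<^sub>0. f j \<in> ncpolys I) \<and> (\<forall>j<m\<^sub>1. g j \<in> ncpolys I)}"

definition word_eval :: "nat \<Rightarrow> ('x \<Rightarrow> real mat) \<Rightarrow> 'x ncword \<Rightarrow> real mat" where
  "word_eval d X w = foldr (\<lambda>x P. X x * P) (letters w) (1\<^sub>m d)"

definition nc_eval :: "nat \<Rightarrow> ('x \<Rightarrow> real mat) \<Rightarrow> 'x ncpoly \<Rightarrow> real mat" where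
  "nc_eval d X f = mat d d (\<lambda>ab.
     \<Sum>w \<in> Poly_Mapping.keys f. Poly_Mapping.lookup f w * (word_eval d X w $$ ab))"

section \<open>Connes' embedding conjecture, in its tracial positivity form\<close>

text \<open>
  This is not the statement about embeddings of II_1 factors but its equivalent form due to
  Klep--Schweighofer and Burgdorf et al., in terms of symmetric polynomials with real
  coefficients and real symmetric matrices.
\<close>

definition Connes_embedding :: bool where
  "Connes_embedding \<longleftrightarrow>
     (\<forall>N :: nat. \<forall>f \<in> ncpolys {1..N}. nc_star f = f \<longrightarrow>
        ((\<forall>d\<ge>1. \<forall>X. (\<forall>i\<in>{1..N}. X i \<in> sym_mats d) \<and>
             1\<^sub>m d - mat d d (\<lambda>ab. \<Sum>i=1..N. (X i * X i) $$ ab) \<in> psd_mats d \<longrightarrow>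
             mat_trace (nc_eval d X f) \<ge> 0)
        \<longleftrightarrow> (\<forall>\<epsilon>>0. f + nc_const \<epsilon> \<in> tr_ball_module {1..N})))"

section \<open>The sets \<open>K\<close> of approximately certified matrices\<close>

definition quartic_poly :: "'x set \<Rightarrow> 'x imat \<Rightarrow> 'x ncpoly" where
  "quartic_poly I M = (\<Sum>i\<in>I. \<Sum>j\<in>I. nc_const (M i j) * nc_var i ^ 2 * nc_var j ^ 2)"

definition K_nc :: "'x set \<Rightarrow> real \<Rightarrow> 'x imat set" where
  "K_nc I \<epsilon> = {M \<in> sym_imats I. quartic_poly I M + nc_const \<epsilon> \<in> tr_ball_module I}"

section \<open>The block matrices of a graph\<close>

text \<open>
  Graphs are symmetric digraphs without loops and multiple arcs, so \<open>u \<rightarrow>\<^bsub>G\<^esub> v\<close> says that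
  \<open>{u, v}\<close> is an edge, and every edge \<open>{u, v}\<close> occurs in \<^const>\<open>arcs_ends\<close> both as \<open>(u, v)\<close> and
  as \<open>(v, u)\<close>.

  Inside a block, the index \<open>0\<close> is \<^const>\<open>None\<close> and \<open>ui\<close> is \<open>Some (u, i)\<close>. An index of the full
  matrix is a pair of a block number and an index in that block.
\<close>

type_synonym 'v bidx = "('v \<times> nat) option"
type_synonym 'v idx = "nat \<times> 'v bidx"

definition block_indices :: "('v, 'e) pre_digraph \<Rightarrow> nat \<Rightarrow> 'v bidx set" where
  "block_indices G t = insert None (Some ` (verts G \<times> {1..t}))"

definition indices :: "('v, 'e) pre_digraph \<Rightarrow> 'v idx set" where
  "indices G = (SIGMA t:{1..card (verts G)}. block_indices G t)"

lemma card_indices: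
  assumes "finite (verts G)"
  shows "card (indices G) = (\<Sum>t=1..card (verts G). card (verts G) * t + 1)"
proof -
  have "card (block_indices G t) = card (verts G) * t + 1" for t
    using assms by (auto simp: block_indices_def card_image card_cartesian_product card_insert_if)
  moreover have "finite (block_indices G t)" for t
    using assms by (simp add: block_indices_def)
  ultimately show ?thesis
    by (simp add: indices_def card_SigmaI)
qed

definition direct_sum :: "('v, 'e) pre_digraph \<Rightarrow> (nat \<Rightarrow> 'v bidx imat) \<Rightarrow> 'v idx imat" where
  "direct_sum G M = (\<lambda>(s, a) (t, b). if s = t \<and> s \<in> {1..card (verts G)} then M s a b else 0)"

definition block_ext :: "nat \<Rightarrow> 'v bidx imat \<Rightarrow> 'v idx imat" where
  "block_ext t M = (\<lambda>(s, a) (s', b). if s = t \<and> s' = t then M a b else 0)"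

definition mat_A_vertex :: "nat \<Rightarrow> 'v \<Rightarrow> 'v bidx imat" where
  "mat_A_vertex t u = (\<lambda>a b. case (a, b) of
       (None, None) \<Rightarrow> 1
     | (None, Some (v, i)) \<Rightarrow> if v = u \<and> i \<in> {1..t} then -1 else 0
     | (Some (v, i), None) \<Rightarrow> if v = u \<and> i \<in> {1..t} then -1 else 0
     | (Some (v, i), Some (w, j)) \<Rightarrow> if v = u \<and> w = u \<and> i \<in> {1..t} \<and> j \<in> {1..t} then 1 else 0)"

definition mat_A :: "('v, 'e) pre_digraph \<Rightarrow> 'v idx imat" where
  "mat_A G = direct_sum G (\<lambda>t a b. \<Sum>u\<in>verts G. mat_A_vertex t u a b)"

definition mat_B :: "('v, 'e) pre_digraph \<Rightarrow> 'v idx imat" where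
  "mat_B G = direct_sum G (\<lambda>t. elem_sym None None)"

definition mat_C :: "('v, 'e) pre_digraph \<Rightarrow> 'v idx imat" where
  "mat_C G = direct_sum G (\<lambda>t a b. real t * elem_sym None None a b)"

definition mat_E :: "nat \<Rightarrow> 'v bidx \<Rightarrow> 'v bidx \<Rightarrow> 'v idx imat" where
  "mat_E t a b = block_ext t (elem_sym a b)"

section \<open>The parameters of a graph\<close>

definition chi_q_feasible :: "('v, 'e) pre_digraph \<Rightarrow> 'v idx imat set" where
  "chi_q_feasible G = {X \<in> closure (cpsd (indices G)).
     imat_inner (indices G) (mat_B G) X = 1 \<and>
     imat_inner (indices G) (mat_A G) X = 0 \<and>
     (\<forall>t\<in>{1..card (verts G)}. \<forall>i\<in>{1..t}. \<forall>u v. u \<rightarrow>\<^bsub>G\<^esub> v \<longrightarrow>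
        imat_inner (indices G) (mat_E t (Some (u, i)) (Some (v, i))) X = 0) \<and>
     (\<forall>t\<in>{1..card (verts G)}. \<forall>i\<in>{1..t}. \<forall>j\<in>{1..t}. \<forall>u\<in>verts G. i \<noteq> j \<longrightarrow>
        imat_inner (indices G) (mat_E t (Some (u, i)) (Some (u, j))) X = 0)}"

definition chi_q_tilde :: "('v, 'e) pre_digraph \<Rightarrow> ereal" where
  "chi_q_tilde G = (INF X \<in> chi_q_feasible G. ereal (imat_inner (indices G) (mat_C G) X))"

text \<open>
  The sum over edges runs over ordered pairs of adjacent vertices. As the matrix of \<open>(u, v)\<close> is
  that of \<open>(v, u)\<close>, the edge \<open>{u, v}\<close> has the free coefficient \<open>y t u v i + y t v u i\<close>.
\<close>

definition dual_slack ::
  "('v, 'e) pre_digraph \<Rightarrow> real \<Rightarrow> real \<Rightarrow> (nat \<Rightarrow> 'v \<Rightarrow> 'v \<Rightarrow> nat \<Rightarrow> real) \<Rightarrow>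
   (nat \<Rightarrow> 'v \<Rightarrow> nat \<Rightarrow> nat \<Rightarrow> real) \<Rightarrow> 'v idx imat" where
  "dual_slack G l m y z = (\<lambda>p q. mat_C G p q - l * mat_B G p q - m * mat_A G p q
     - (\<Sum>t=1..card (verts G). \<Sum>i=1..t. \<Sum>(u, v)\<in>arcs_ends G.
          y t u v i * mat_E t (Some (u, i)) (Some (v, i)) p q)
     - (\<Sum>t=1..card (verts G). \<Sum>i=1..t. \<Sum>j\<in>{1..t} - {i}. \<Sum>u\<in>verts G.
          z t u i j * mat_E t (Some (u, i)) (Some (u, j)) p q))"

definition Psi :: "real \<Rightarrow> ('v, 'e) pre_digraph \<Rightarrow> ereal" where
  "Psi \<epsilon> G = Sup {ereal l | l m y z. dual_slack G l m y z \<in> K_nc (indices G) \<epsilon>}"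

end

theory Submission
  imports Defs "HOL-Analysis.Convex"
begin

text \<open>
  Let \<open>\<lambda>\<close> be smaller than the optimal value of the primal program. On the compact base of the closed
  cone cut out by \<open>trace = 1\<close>, the function \<open>\<langle>C - \<lambda> B, X\<rangle>\<close> is positive wherever the homogeneous constraints
  hold, because these constraints together with \<open>\<langle>B, X\<rangle> = 0\<close> force the trace to vanish. A compactness
  argument turns this into multipliers for which the dual slack matrix is nonnegative on the whole
  cone. Connes' hypothesis certifies that matrix for every \<open>\<epsilon> > 0\<close>, since the trace of its quartic
  polynomial at \<open>(X\<^sub>i)\<close> is its inner product with the Gram matrix of the \<open>X\<^sub>i\<^sup>2\<close>.
\<close>

section \<open>Additive functions of non-commutative polynomials\<close>

lemma poly_mapping_eq_sum_single:
  fixes f :: "'a \<Rightarrow>\<^sub>0 'b::comm_monoid_add"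
  shows "f = (\<Sum>w\<in>Poly_Mapping.keys f. Poly_Mapping.single w (Poly_Mapping.lookup f w))"
  by (rule poly_mapping_eqI)
    (auto simp: lookup_sum lookup_single when_def in_keys_iff if_distrib sum.delta)

text \<open>Cancellation in \<open>f + g\<close> can remove keys, so all three sums are first
  extended to the union of the two supports; \<open>H w 0 = 0\<close> makes the extra terms
  vanish.\<close>

lemma sum_keys_add:
  fixes f g :: "'a \<Rightarrow>\<^sub>0 'b::comm_monoid_add" and H :: "'a \<Rightarrow> 'b \<Rightarrow> 'c::comm_monoid_add"
  assumes add: "\<And>w a b. H w (a + b) = H w a + H w b" and zero: "\<And>w. H w 0 = 0"
  shows "(\<Sum>w\<in>Poly_Mapping.keys (f + g). H w (Poly_Mapping.lookup (f + g) w)) =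
    (\<Sum>w\<in>Poly_Mapping.keys f. H w (Poly_Mapping.lookup f w)) +
    (\<Sum>w\<in>Poly_Mapping.keys g. H w (Poly_Mapping.lookup g w))"
proof -
  let ?S = "Poly_Mapping.keys f \<union> Poly_Mapping.keys g"
  have ext: "(\<Sum>w\<in>Poly_Mapping.keys h. H w (Poly_Mapping.lookup h w)) =
      (\<Sum>w\<in>?S. H w (Poly_Mapping.lookup h w))" if "Poly_Mapping.keys h \<subseteq> ?S" for h
    using that by (intro sum.mono_neutral_left) (auto simp: zero in_keys_iff)
  show ?thesis
    unfolding ext[OF Poly_Mapping.keys_add] ext[of f, simplified] ext[of g, simplified]
    by (simp add: lookup_add add sum.distrib)
qed

text \<open>\<open>Connes_embedding\<close> speaks of the variables \<open>{1..N}\<close>, the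
  program has one variable for each element of \<open>indices G\<close>; certificates are carried
  across by renaming. A sum of renamed monomials gives an algebra homomorphism for every
  \<open>\<phi>\<close>, injective or not.\<close>

definition nc_rename :: "('x \<Rightarrow> 'y) \<Rightarrow> 'x ncpoly \<Rightarrow> 'y ncpoly" where
  "nc_rename \<phi> f = (\<Sum>w\<in>Poly_Mapping.keys f.
     Poly_Mapping.single (NCWord (map \<phi> (letters w))) (Poly_Mapping.lookup f w))"

lemma nc_rename_0 [simp]: "nc_rename \<phi> 0 = 0"
  by (simp add: nc_rename_def)

lemma nc_rename_single [simp]:
  "nc_rename \<phi> (Poly_Mapping.single w c) = Poly_Mapping.single (NCWord (map \<phi> (letters w))) c"
  by (simp add: nc_rename_def)

lemma nc_rename_add: "nc_rename \<phi> (f + g) = nc_rename \<phi> f + nc_rename \<phi> g"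
  unfolding nc_rename_def by (rule sum_keys_add) (simp_all add: single_add)

lemma nc_rename_sum: "nc_rename \<phi> (\<Sum>i\<in>A. f i) = (\<Sum>i\<in>A. nc_rename \<phi> (f i))"
  by (induction A rule: infinite_finite_induct) (simp_all add: nc_rename_add)

lemma nc_rename_diff: "nc_rename \<phi> (f - g) = nc_rename \<phi> f - nc_rename \<phi> g"
  using nc_rename_add[of \<phi> "f - g" g] by simp

text \<open>Concatenation of words commutes with \<open>map\<close>, which settles monomials; both
  factors are expanded into these.\<close>

lemma nc_rename_mult: "nc_rename \<phi> (f * g) = nc_rename \<phi> f * nc_rename \<phi> g"
proof -
  have "nc_rename \<phi> (f * g) =
    (\<Sum>v\<in>Poly_Mapping.keys f. \<Sum>w\<in>Poly_Mapping.keys g.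
       nc_rename \<phi> (Poly_Mapping.single v (Poly_Mapping.lookup f v)
         * Poly_Mapping.single w (Poly_Mapping.lookup g w)))"
    by (subst (1) poly_mapping_eq_sum_single[of f], subst (1) poly_mapping_eq_sum_single[of g])
      (simp add: sum_product nc_rename_sum)
  also have "\<dots> = (\<Sum>v\<in>Poly_Mapping.keys f. \<Sum>w\<in>Poly_Mapping.keys g.
       Poly_Mapping.single (NCWord (map \<phi> (letters v))) (Poly_Mapping.lookup f v)
         * Poly_Mapping.single (NCWord (map \<phi> (letters w))) (Poly_Mapping.lookup g w))"
    by (simp add: mult_single plus_ncword_def)
  also have "\<dots> = nc_rename \<phi> f * nc_rename \<phi> g"
    by (simp add: nc_rename_def sum_product)
  finally show ?thesis .
qed

lemma nc_rename_1 [simp]: "nc_rename \<phi> 1 = 1"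
  unfolding single_one[symmetric] nc_rename_single by (simp add: zero_ncword_def)

lemma nc_rename_const [simp]: "nc_rename \<phi> (nc_const c) = nc_const c"
  by (simp add: nc_const_def zero_ncword_def)

lemma nc_rename_var [simp]: "nc_rename \<phi> (nc_var x) = nc_var (\<phi> x)"
  by (simp add: nc_var_def)

lemma nc_star_0 [simp]: "nc_star 0 = 0"
  by (rule poly_mapping_eqI) (simp add: lookup_nc_star)

lemma nc_star_add: "nc_star (f + g) = nc_star f + nc_star g"
  by (rule poly_mapping_eqI) (simp add: lookup_nc_star lookup_add)

lemma nc_star_sum: "nc_star (\<Sum>i\<in>A. f i) = (\<Sum>i\<in>A. nc_star (f i))"
  by (induction A rule: infinite_finite_induct) (simp_all add: nc_star_add)

lemma rev_ncword_rev_ncword [simp]: "rev_ncword (rev_ncword w) = w"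
  by (simp add: rev_ncword_def)

lemma nc_star_single [simp]:
  "nc_star (Poly_Mapping.single w c) = Poly_Mapping.single (rev_ncword w) c"
proof (rule poly_mapping_eqI)
  fix v
  have "w = rev_ncword v \<longleftrightarrow> rev_ncword w = v"
    using rev_ncword_rev_ncword by metis
  then show "Poly_Mapping.lookup (nc_star (Poly_Mapping.single w c)) v =
      Poly_Mapping.lookup (Poly_Mapping.single (rev_ncword w) c) v"
    by (simp add: lookup_nc_star lookup_single)
qed

lemma nc_rename_star: "nc_rename \<phi> (nc_star f) = nc_star (nc_rename \<phi> f)"
proof -
  have "nc_rename \<phi> (nc_star f) = (\<Sum>w\<in>Poly_Mapping.keys f.
      nc_rename \<phi> (nc_star (Poly_Mapping.single w (Poly_Mapping.lookup f w))))"
    by (subst (1) poly_mapping_eq_sum_single[of f]) (simp only: nc_star_sum nc_rename_sum)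
  also have "\<dots> = (\<Sum>w\<in>Poly_Mapping.keys f.
      nc_star (Poly_Mapping.single (NCWord (map \<phi> (letters w))) (Poly_Mapping.lookup f w)))"
    by (simp add: rev_ncword_def rev_map)
  also have "\<dots> = nc_star (nc_rename \<phi> f)"
    by (simp only: nc_rename_def nc_star_sum)
  finally show ?thesis .
qed

lemma nc_rename_in_ncpolys:
  assumes "f \<in> ncpolys A" "\<phi> ` A \<subseteq> B"
  shows "nc_rename \<phi> f \<in> ncpolys B"
proof -
  have "Poly_Mapping.keys (nc_rename \<phi> f) \<subseteq>
      (\<Union>w\<in>Poly_Mapping.keys f. {NCWord (map \<phi> (letters w))})"
    unfolding nc_rename_def by (rule order_trans[OF keys_sum]) auto
  then show ?thesis
    using assms unfolding ncpolys_def by fastforce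
qed

lemma nc_rename_commutator_sums:
  assumes "h \<in> nc_commutator_sums A" "\<phi> ` A \<subseteq> B"
  shows "nc_rename \<phi> h \<in> nc_commutator_sums B"
proof -
  obtain k :: nat and a b where h: "h = (\<Sum>j<k. a j * b j - b j * a j)"
    and ab: "\<forall>j<k. a j \<in> ncpolys A \<and> b j \<in> ncpolys A"
    using assms(1) unfolding nc_commutator_sums_def by blast
  have "nc_rename \<phi> h = (\<Sum>j<k. nc_rename \<phi> (a j) * nc_rename \<phi> (b j)
      - nc_rename \<phi> (b j) * nc_rename \<phi> (a j))"
    by (simp add: h nc_rename_sum nc_rename_diff nc_rename_mult)
  then show ?thesis
    using ab nc_rename_in_ncpolys[OF _ assms(2)] unfolding nc_commutator_sums_def
    by (intro CollectI exI[of _ k] exI[of _ "\<lambda>j. nc_rename \<phi> (a j)"]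
        exI[of _ "\<lambda>j. nc_rename \<phi> (b j)"]) auto
qed

text \<open>A homomorphism that commutes with \<open>nc_star\<close> preserves commutators and
  hermitian squares. The ball polynomial calls for a bijection: each square
  \<open>nc_var i ^ 2\<close> with \<open>i\<close> in \<open>B\<close> has to arise exactly
  once.\<close>

lemma nc_rename_tr_ball_module:
  assumes "p \<in> tr_ball_module A" and bij: "bij_betw \<phi> A B"
  shows "nc_rename \<phi> p \<in> tr_ball_module B"
proof -
  have img: "\<phi> ` A \<subseteq> B"
    using bij by (simp add: bij_betw_def)
  obtain h f g and m\<^sub>0 m\<^sub>1 :: nat where p: "p = h + (\<Sum>j<m\<^sub>0. f j * nc_star (f j))
      + (\<Sum>j<m\<^sub>1. g j * (1 - (\<Sum>i\<in>A. nc_var i ^ 2)) * nc_star (g j))"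
    and h: "h \<in> nc_commutator_sums A"
    and fg: "\<forall>j<m\<^sub>0. f j \<in> ncpolys A" "\<forall>j<m\<^sub>1. g j \<in> ncpolys A"
    using assms(1) unfolding tr_ball_module_def by blast
  have ball: "nc_rename \<phi> (1 - (\<Sum>i\<in>A. nc_var i ^ 2)) = 1 - (\<Sum>i\<in>B. nc_var i ^ 2)"
    using sum.reindex_bij_betw[OF bij, of "\<lambda>i. nc_var i ^ 2"]
    by (simp add: nc_rename_sum nc_rename_diff nc_rename_mult power2_eq_square)
  have "nc_rename \<phi> p = nc_rename \<phi> h
      + (\<Sum>j<m\<^sub>0. nc_rename \<phi> (f j) * nc_star (nc_rename \<phi> (f j)))
      + (\<Sum>j<m\<^sub>1. nc_rename \<phi> (g j) * (1 - (\<Sum>i\<in>B. nc_var i ^ 2)) * nc_star (nc_rename \<phi> (g j)))"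
    by (simp only: p nc_rename_sum nc_rename_add nc_rename_mult nc_rename_star ball)
  then show ?thesis
    using nc_rename_commutator_sums[OF h img] nc_rename_in_ncpolys[OF _ img] fg
    unfolding tr_ball_module_def
    by (intro CollectI exI[of _ "nc_rename \<phi> h"] exI[of _ m\<^sub>0] exI[of _ m\<^sub>1]
        exI[of _ "\<lambda>j. nc_rename \<phi> (f j)"] exI[of _ "\<lambda>j. nc_rename \<phi> (g j)"]) auto
qed

section \<open>The quartic polynomial and traces of evaluations\<close>

lemma quartic_poly_eq:
  "quartic_poly I M = (\<Sum>i\<in>I. \<Sum>j\<in>I. Poly_Mapping.single (NCWord [i, i, j, j]) (M i j))"
  by (simp add: quartic_poly_def nc_const_def nc_var_def power2_eq_square mult_single
      plus_ncword_def zero_ncword_def mult.assoc)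

lemma quartic_poly_in_ncpolys: "quartic_poly I M \<in> ncpolys I"
proof -
  have "Poly_Mapping.keys (quartic_poly I M) \<subseteq> (\<Union>i\<in>I. \<Union>j\<in>I. {NCWord [i, i, j, j]})"
    unfolding quartic_poly_eq
    by (rule order_trans[OF keys_sum] UN_mono order_refl | simp)+
  then show ?thesis
    unfolding ncpolys_def by fastforce
qed

text \<open>Reversing the word \<open>[i, i, j, j]\<close> gives \<open>[j, j, i, i]\<close>, so the
  star exchanges the two summation indices.\<close>

lemma nc_star_quartic_poly:
  assumes "\<And>i j. i \<in> I \<Longrightarrow> j \<in> I \<Longrightarrow> M i j = M j i"
  shows "nc_star (quartic_poly I M) = quartic_poly I M"
  unfolding quartic_poly_eq
  by (subst (2) sum.swap) (auto simp: nc_star_sum rev_ncword_def assms intro!: sum.cong)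

lemma nc_rename_quartic_poly:
  assumes bij: "bij_betw \<phi> A B"
  shows "nc_rename \<phi> (quartic_poly A (\<lambda>i j. M (\<phi> i) (\<phi> j))) = quartic_poly B M"
  by (simp add: quartic_poly_eq nc_rename_sum sum.reindex_bij_betw[OF bij, symmetric])

text \<open>This brings the trace into the shape of a sum over keys, to which
  \<open>sum_keys_add\<close> applies.\<close>

lemma mat_trace_nc_eval:
  "mat_trace (nc_eval d X f) = (\<Sum>w\<in>Poly_Mapping.keys f.
     Poly_Mapping.lookup f w * (\<Sum>a<d. word_eval d X w $$ (a, a)))"
  unfolding mat_trace_def nc_eval_def
  by (simp add: sum_distrib_left) (rule sum.swap)

lemma mat_trace_nc_eval_add:
  "mat_trace (nc_eval d X (f + g)) = mat_trace (nc_eval d X f) + mat_trace (nc_eval d X g)"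
  unfolding mat_trace_nc_eval by (rule sum_keys_add) (simp_all add: distrib_right)

lemma mat_trace_nc_eval_sum:
  "mat_trace (nc_eval d X (\<Sum>i\<in>A. f i)) = (\<Sum>i\<in>A. mat_trace (nc_eval d X (f i)))"
  by (induction A rule: infinite_finite_induct)
    (simp_all add: mat_trace_nc_eval_add, simp_all add: mat_trace_nc_eval)

lemma mat_trace_nc_eval_single:
  assumes "word_eval d X w \<in> carrier_mat d d"
  shows "mat_trace (nc_eval d X (Poly_Mapping.single w c)) = c * mat_trace (word_eval d X w)"
  unfolding mat_trace_nc_eval using assms by (simp add: mat_trace_def)

section \<open>Positivity on the completely positive semidefinite cone\<close>

lemma sym_matsD: "A \<in> sym_mats d \<Longrightarrow> A \<in> carrier_mat d d"
  by (simp add: sym_mats_def)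

lemma sym_mats_nth: "A \<in> sym_mats d \<Longrightarrow> i < d \<Longrightarrow> j < d \<Longrightarrow> A $$ (i, j) = A $$ (j, i)"
  unfolding sym_mats_def by (metis (mono_tags, lifting) carrier_matD index_transpose_mat(1) mem_Collect_eq)

lemma psd_matsD: "A \<in> psd_mats d \<Longrightarrow> A \<in> sym_mats d"
  by (simp add: psd_mats_def)

text \<open>The quadratic form of \<open>X * X\<close> at \<open>v\<close> is the squared length of
  \<open>X v\<close>, by symmetry of \<open>X\<close>.\<close>

lemma psd_mats_square:
  assumes "X \<in> sym_mats d"
  shows "X * X \<in> psd_mats d"
proof -
  have c: "X \<in> carrier_mat d d" and t: "transpose_mat X = X"
    using assms by (simp_all add: sym_mats_def)
  have "0 \<le> scalar_prod v ((X * X) *\<^sub>v v)" if v: "v \<in> carrier_vec d" for v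
  proof -
    have "scalar_prod v ((X * X) *\<^sub>v v) = scalar_prod (X *\<^sub>v v) (X *\<^sub>v v)"
      using transpose_vec_mult_scalar[of X d d "X *\<^sub>v v" v] c v t by simp
    then show ?thesis
      by (simp add: scalar_prod_def sum_nonneg)
  qed
  then show ?thesis
    using c t by (simp add: psd_mats_def sym_mats_def transpose_mult[of _ d d _ d])
qed

lemma mat_trace_mult:
  assumes "X \<in> carrier_mat d d" "Y \<in> carrier_mat d d"
  shows "mat_trace (X * Y) = (\<Sum>i<d. \<Sum>j<d. X $$ (i, j) * Y $$ (j, i))"
  using assms by (simp add: mat_trace_def scalar_prod_def lessThan_atLeast0)

lemma mat_trace_mult_comm:
  assumes "X \<in> carrier_mat d d" "Y \<in> carrier_mat d d"
  shows "mat_trace (X * Y) = mat_trace (Y * X)"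
  unfolding mat_trace_mult[OF assms] mat_trace_mult[OF assms(2,1)]
  by (subst sum.swap) (simp add: mult.commute)

text \<open>On symmetric matrices the trace product is the Euclidean inner product of the arrays of
  entries; nonnegative diagonals and the Cauchy-Schwarz inequality for the cone come from
  this.\<close>

lemma mat_trace_mult_sym:
  assumes "X \<in> sym_mats d" "Y \<in> sym_mats d"
  shows "mat_trace (X * Y) = (\<Sum>i<d. \<Sum>j<d. X $$ (i, j) * Y $$ (i, j))"
  unfolding mat_trace_mult[OF assms[THEN sym_matsD]]
  using sym_mats_nth[OF assms(2)] by (auto intro!: sum.cong)

lemma mat_trace_quartic_poly:
  assumes X: "\<And>i. i \<in> I \<Longrightarrow> X i \<in> carrier_mat d d"
  shows "mat_trace (nc_eval d X (quartic_poly I M)) =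
    (\<Sum>i\<in>I. \<Sum>j\<in>I. M i j * mat_trace ((X i * X i) * (X j * X j)))"
  unfolding quartic_poly_eq mat_trace_nc_eval_sum
proof (intro sum.cong refl)
  fix i j assume ij: "i \<in> I" "j \<in> I"
  have "word_eval d X (NCWord [i, i, j, j]) = (X i * X i) * (X j * X j)"
    using X[OF ij(1)] X[OF ij(2)]
    by (simp add: word_eval_def assoc_mult_mat[of "X i" d d "X i" d "X j * X j" d])
  then show "mat_trace (nc_eval d X (Poly_Mapping.single (NCWord [i, i, j, j]) (M i j))) =
      M i j * mat_trace ((X i * X i) * (X j * X j))"
    using X ij by (simp add: mat_trace_nc_eval_single mult_carrier_mat[of _ d d _ d])
qed

text \<open>Only the squares of symmetric matrices enter the quartic polynomial, and these are positive
  semidefinite: the trace is the inner product of \<open>M\<close> with a matrix in the cone.\<close>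

lemma K_nc_of_cpsd_dual:
  assumes Connes: "Connes_embedding" and "finite I" and M: "M \<in> sym_imats I"
    and pos: "\<And>X. X \<in> cpsd I \<Longrightarrow> 0 \<le> imat_inner I M X" and \<epsilon>: "0 < \<epsilon>"
  shows "M \<in> K_nc I \<epsilon>"
proof -
  define N where "N = card I"
  obtain \<phi> where bij: "bij_betw \<phi> {1..N} I"
    using ex_bij_betw_nat_finite_1[OF \<open>finite I\<close>] N_def by auto
  \<comment> \<open>The hypothesis quantifies over matrices indexed by \<open>{1..N}\<close>, the
    cone wants them indexed by \<open>I\<close>; \<open>\<psi>\<close> inverts the
    numbering.\<close>
  define \<psi> where "\<psi> = the_inv_into {1..N} \<phi>"
  have \<psi>: "\<psi> (\<phi> i) = i" if "i \<in> {1..N}" for i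
    using bij that unfolding \<psi>_def bij_betw_def by (simp add: the_inv_into_f_f)
  have \<psi>_mem: "\<psi> p \<in> {1..N}" if "p \<in> I" for p
    using bij \<psi> that unfolding bij_betw_def by auto
  define f where "f = quartic_poly {1..N} (\<lambda>i j. M (\<phi> i) (\<phi> j))"
  have "0 \<le> mat_trace (nc_eval d X f)"
    if d: "1 \<le> d" and X: "\<forall>i\<in>{1..N}. X i \<in> sym_mats d" for d X
  proof -
    define Y where "Y p = X (\<psi> p) * X (\<psi> p)" for p
    have Y: "Y p \<in> psd_mats d" if "p \<in> I" for p
      using X \<psi>_mem[OF that] by (simp add: Y_def psd_mats_square)
    \<comment> \<open>The Gram matrix of the \<open>Y p\<close>, set to 0 off \<open>I\<close>
      because members of \<open>sym_imats I\<close> vanish there.\<close>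
    define T where "T p q = (if p \<in> I \<and> q \<in> I then mat_trace (Y p * Y q) else 0)" for p q
    have Y_carrier: "Y p \<in> carrier_mat d d" if "p \<in> I" for p
      using Y[OF that] by (simp add: psd_mats_def sym_mats_def)
    have "T \<in> sym_imats I"
      unfolding sym_imats_def T_def using mat_trace_mult_comm Y_carrier by auto
    then have "T \<in> cpsd I"
      unfolding cpsd_def using d Y by (auto simp: T_def intro!: exI[of _ d] exI[of _ Y])
    have X': "X i \<in> carrier_mat d d" if "i \<in> {1..N}" for i
      using X that by (simp add: sym_mats_def)
    have "mat_trace (nc_eval d X f) =
        (\<Sum>i\<in>{1..N}. \<Sum>j\<in>{1..N}. M (\<phi> i) (\<phi> j) * mat_trace (Y (\<phi> i) * Y (\<phi> j)))"
      unfolding f_def using X' by (subst mat_trace_quartic_poly) (simp_all add: Y_def \<psi>)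
    also have "\<dots> = (\<Sum>p\<in>I. \<Sum>q\<in>I. M p q * mat_trace (Y p * Y q))"
      by (simp add: sum.reindex_bij_betw[OF bij, symmetric])
    \<comment> \<open>\<open>imat_inner\<close> reads its second argument transposed, hence the
      exchange of factors under the trace.\<close>
    also have "\<dots> = imat_inner I M T"
      unfolding imat_inner_def T_def
      by (intro sum.cong refl) (simp add: mat_trace_mult_comm[OF Y_carrier Y_carrier])
    finally show ?thesis
      using pos[OF \<open>T \<in> cpsd I\<close>] by simp
  qed
  moreover have "f \<in> ncpolys {1..N}"
    unfolding f_def by (rule quartic_poly_in_ncpolys)
  moreover have "nc_star f = f"
    unfolding f_def using M by (intro nc_star_quartic_poly) (simp add: sym_imats_def)
  ultimately have "f + nc_const \<epsilon> \<in> tr_ball_module {1..N}"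
    using Connes \<epsilon> unfolding Connes_embedding_def by blast
  \<comment> \<open>Renaming along \<open>\<phi>\<close> turns the certificate over
    \<open>{1..N}\<close> into one over \<open>I\<close>.\<close>
  from nc_rename_tr_ball_module[OF this bij] show ?thesis
    using M nc_rename_quartic_poly[OF bij, of M] by (simp add: K_nc_def f_def nc_rename_add)
qed

section \<open>The cone is convex and its matrices satisfy the Cauchy-Schwarz inequality\<close>

text \<open>Representing matrices placed on complementary blocks have trace products that add up.
  This makes the cone closed under sums, even when the two representations differ in size.\<close>

definition block_diag :: "nat \<Rightarrow> nat \<Rightarrow> real mat \<Rightarrow> real mat \<Rightarrow> real mat" where
  "block_diag m n X Y = four_block_mat X (0\<^sub>m m n) (0\<^sub>m n m) Y"

lemma block_diag_psd:
  assumes X: "X \<in> psd_mats m" and Y: "Y \<in> psd_mats n"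
  shows "block_diag m n X Y \<in> psd_mats (m + n)"
proof -
  have c: "X \<in> carrier_mat m m" "Y \<in> carrier_mat n n"
    and t: "transpose_mat X = X" "transpose_mat Y = Y"
    using X Y by (simp_all add: psd_mats_def sym_mats_def)
  have "0 \<le> scalar_prod v (block_diag m n X Y *\<^sub>v v)" if v: "v \<in> carrier_vec (m + n)" for v
  proof -
    have f: "vec_first v m \<in> carrier_vec m" and l: "vec_last v n \<in> carrier_vec n"
      by simp_all
    \<comment> \<open>The quadratic form splits along the first \<open>m\<close> and the last
      \<open>n\<close> coordinates of \<open>v\<close>.\<close>
    have "scalar_prod v (block_diag m n X Y *\<^sub>v v) =
        scalar_prod (vec_first v m @\<^sub>v vec_last v n)
          (block_diag m n X Y *\<^sub>v (vec_first v m @\<^sub>v vec_last v n))"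
      using v by simp
    also have "\<dots> = scalar_prod (vec_first v m) (X *\<^sub>v vec_first v m)
        + scalar_prod (vec_last v n) (Y *\<^sub>v vec_last v n)"
      unfolding block_diag_def mult_mat_vec_split[OF c f l]
      using c by (intro scalar_prod_append[OF f l]) auto
    also have "\<dots> \<ge> 0"
      using X Y f l by (simp add: psd_mats_def)
    finally show ?thesis .
  qed
  moreover have "transpose_mat (block_diag m n X Y) = block_diag m n X Y"
    unfolding block_diag_def using c t by (subst transpose_four_block_mat[OF c(1) _ _ c(2)]) simp_all
  ultimately show ?thesis
    using c by (simp add: psd_mats_def sym_mats_def block_diag_def)
qed

lemma mat_trace_block_diag_mult:
  assumes X: "X \<in> carrier_mat m m" "X' \<in> carrier_mat m m"
    and Y: "Y \<in> carrier_mat n n" "Y' \<in> carrier_mat n n"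
  shows "mat_trace (block_diag m n X Y * block_diag m n X' Y') =
    mat_trace (X * X') + mat_trace (Y * Y')"
proof -
  have eq: "block_diag m n X Y * block_diag m n X' Y' = block_diag m n (X * X') (Y * Y')"
    unfolding block_diag_def using X Y
    by (subst mult_four_block_mat[OF X(1) _ _ Y(1) X(2) _ _ Y(2)]) simp_all
  have "mat_trace (block_diag m n P Q) = mat_trace P + mat_trace Q"
    if "P \<in> carrier_mat m m" "Q \<in> carrier_mat n n" for P Q
  proof -
    have "mat_trace (block_diag m n P Q) =
        (\<Sum>i<m + n. if i < m then P $$ (i, i) else Q $$ (i - m, i - m))"
      unfolding mat_trace_def block_diag_def using that
      by (intro sum.cong) (auto simp: carrier_matD)
    also have "\<dots> = (\<Sum>i<m. P $$ (i, i)) + (\<Sum>i<n. Q $$ (i, i))"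
      unfolding lessThan_atLeast0
        sum.atLeastLessThan_concat[OF le0 le_add1, symmetric]
      using sum.shift_bounds_nat_ivl[of "\<lambda>i. if i < m then P $$ (i, i) else Q $$ (i - m, i - m)" 0 m n]
      by (simp add: add.commute)
    also have "\<dots> = mat_trace P + mat_trace Q"
      using that by (simp add: mat_trace_def)
    finally show ?thesis .
  qed
  then show ?thesis
    using X Y by (simp add: eq)
qed

lemma cpsd_add:
  assumes A: "A \<in> cpsd I" and B: "B \<in> cpsd I"
  shows "(\<lambda>p q. A p q + B p q) \<in> cpsd I"
proof -
  obtain m X where m: "1 \<le> m" and X: "\<And>p. p \<in> I \<Longrightarrow> X p \<in> psd_mats m"
    and AX: "\<And>p q. p \<in> I \<Longrightarrow> q \<in> I \<Longrightarrow> A p q = mat_trace (X p * X q)"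
    using A unfolding cpsd_def by blast
  obtain n Y where n: "1 \<le> n" and Y: "\<And>p. p \<in> I \<Longrightarrow> Y p \<in> psd_mats n"
    and BY: "\<And>p q. p \<in> I \<Longrightarrow> q \<in> I \<Longrightarrow> B p q = mat_trace (Y p * Y q)"
    using B unfolding cpsd_def by blast
  have c: "X p \<in> carrier_mat m m" "Y p \<in> carrier_mat n n" if "p \<in> I" for p
    using X[OF that] Y[OF that] by (simp_all add: psd_mats_def sym_mats_def)
  have "(\<lambda>p q. A p q + B p q) \<in> sym_imats I"
    using A B by (auto simp: cpsd_def sym_imats_def)
  moreover have "\<forall>p\<in>I. block_diag m n (X p) (Y p) \<in> psd_mats (m + n)"
    using X Y block_diag_psd by blast
  moreover have "\<forall>p\<in>I. \<forall>q\<in>I. A p q + B p q =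
      mat_trace (block_diag m n (X p) (Y p) * block_diag m n (X q) (Y q))"
    using AX BY c by (simp add: mat_trace_block_diag_mult)
  ultimately show ?thesis
    unfolding cpsd_def using m
    by (intro CollectI conjI exI[of _ "m + n"] exI[of _ "\<lambda>p. block_diag m n (X p) (Y p)"]) auto
qed

text \<open>Multiplying every representing matrix by \<open>sqrt c\<close> multiplies each trace
  product by \<open>c\<close>.\<close>

lemma cpsd_scale:
  assumes A: "A \<in> cpsd I" and c: "0 \<le> c"
  shows "(\<lambda>p q. c * A p q) \<in> cpsd I"
proof -
  obtain d X where d: "1 \<le> d" and X: "\<And>p. p \<in> I \<Longrightarrow> X p \<in> psd_mats d"
    and AX: "\<And>p q. p \<in> I \<Longrightarrow> q \<in> I \<Longrightarrow> A p q = mat_trace (X p * X q)"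
    using A unfolding cpsd_def by blast
  have X': "X p \<in> carrier_mat d d" if "p \<in> I" for p
    using X[OF that] by (simp add: psd_mats_def sym_mats_def)
  have "sqrt c \<cdot>\<^sub>m X p \<in> psd_mats d" if "p \<in> I" for p
  proof -
    have "transpose_mat (sqrt c \<cdot>\<^sub>m X p) = sqrt c \<cdot>\<^sub>m X p"
      using sym_mats_nth[OF psd_matsD[OF X[OF that]]] X'[OF that] by (intro eq_matI) auto
    moreover have "scalar_prod v ((sqrt c \<cdot>\<^sub>m X p) *\<^sub>v v) = sqrt c * scalar_prod v (X p *\<^sub>v v)"
      if v: "v \<in> carrier_vec d" for v
      using X'[OF \<open>p \<in> I\<close>] v by (simp add: scalar_prod_def sum_distrib_left algebra_simps)
    ultimately show ?thesis
      using X[OF that] c by (simp add: psd_mats_def sym_mats_def)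
  qed
  moreover have "c * A p q = mat_trace ((sqrt c \<cdot>\<^sub>m X p) * (sqrt c \<cdot>\<^sub>m X q))"
    if "p \<in> I" "q \<in> I" for p q
  proof -
    have sq: "(sqrt c * x) * (sqrt c * y) = c * (x * y)" for x y :: real
    proof -
      have "(sqrt c * x) * (sqrt c * y) = (sqrt c * sqrt c) * (x * y)"
        by (simp only: mult_ac)
      then show ?thesis
        using c by simp
    qed
    have "mat_trace ((sqrt c \<cdot>\<^sub>m X p) * (sqrt c \<cdot>\<^sub>m X q)) =
        (\<Sum>i<d. \<Sum>j<d. (sqrt c * X p $$ (i, j)) * (sqrt c * X q $$ (j, i)))"
      using X'[OF that(1)] X'[OF that(2)] by (simp add: mat_trace_mult[of _ d])
    also have "\<dots> = c * mat_trace (X p * X q)"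
      by (simp only: sq mat_trace_mult[OF X'[OF that(1)] X'[OF that(2)]] sum_distrib_left)
    finally show ?thesis
      by (simp add: AX[OF that])
  qed
  moreover have "(\<lambda>p q. c * A p q) \<in> sym_imats I"
    using A by (auto simp: cpsd_def sym_imats_def)
  ultimately show ?thesis
    unfolding cpsd_def using d
    by (intro CollectI conjI exI[of _ d] exI[of _ "\<lambda>p. sqrt c \<cdot>\<^sub>m X p"]) auto
qed

lemma cpsd_diag_nonneg:
  assumes "A \<in> cpsd I"
  shows "0 \<le> A p p"
proof (cases "p \<in> I")
  case True
  obtain d X where X: "X p \<in> psd_mats d" and A: "A p p = mat_trace (X p * X p)"
    using assms True unfolding cpsd_def by blast
  show ?thesis
    unfolding A mat_trace_mult_sym[OF X[THEN psd_matsD] X[THEN psd_matsD]]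
    by (intro sum_nonneg) simp
next
  case False
  then show ?thesis
    using assms by (simp add: cpsd_def sym_imats_def)
qed

text \<open>Inside \<open>I\<close> this is the classical inequality for the entries of
  \<open>X p\<close> and \<open>X q\<close>, read as vectors over pairs of positions; elsewhere the
  left side is 0.\<close>

lemma cpsd_Cauchy_Schwarz:
  assumes "A \<in> cpsd I"
  shows "(A p q)\<^sup>2 \<le> A p p * A q q"
proof (cases "p \<in> I \<and> q \<in> I")
  case True
  then obtain d X where X: "X p \<in> psd_mats d" "X q \<in> psd_mats d"
    and A: "A p q = mat_trace (X p * X q)" "A p p = mat_trace (X p * X p)"
      "A q q = mat_trace (X q * X q)"
    using assms unfolding cpsd_def by blast
  show ?thesis
    unfolding A mat_trace_mult_sym[OF X[THEN psd_matsD]]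
      mat_trace_mult_sym[OF X(1)[THEN psd_matsD] X(1)[THEN psd_matsD]]
      mat_trace_mult_sym[OF X(2)[THEN psd_matsD] X(2)[THEN psd_matsD]]
      sum.cartesian_product
    using Cauchy_Schwarz_ineq_sum[of "\<lambda>x. X p $$ (fst x, snd x)" "\<lambda>x. X q $$ (fst x, snd x)"
        "{..<d} \<times> {..<d}"]
    by (simp only: case_prod_unfold power2_eq_square)
next
  case False
  then have "A p q = 0"
    using assms by (auto simp: cpsd_def sym_imats_def)
  then show ?thesis
    using cpsd_diag_nonneg[OF assms] by simp
qed

section \<open>Passage to the closure of the cone\<close>

lemma continuous_on_imat_entry [continuous_intros]:
  "continuous_on S (\<lambda>X. X p q :: real)"
  by (rule continuous_on_product_then_coordinatewise[where i = q])
    (rule continuous_on_product_then_coordinatewise[OF continuous_on_id])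

lemma continuous_on_imatI:
  assumes "\<And>p q. continuous_on S (\<lambda>x. F x p q :: real)"
  shows "continuous_on S F"
  by (intro continuous_on_coordinatewise_then_product assms)

text \<open>Addition is continuous on pairs and maps pairs from the cone into it, hence maps the
  closure of the product, which is the product of the closures, into the closure.\<close>

lemma closure_cpsd_add:
  assumes "A \<in> closure (cpsd I)" "B \<in> closure (cpsd I)"
  shows "(\<lambda>p q. A p q + B p q) \<in> closure (cpsd I)"
proof -
  let ?F = "\<lambda>Z p q. fst Z p q + snd Z p q :: real"
  have "continuous_on S ?F" for S :: "('i imat \<times> 'i imat) set"
    by (intro continuous_on_imatI continuous_on_add
        continuous_on_compose2[OF continuous_on_imat_entry[of UNIV] continuous_on_fst[OF continuous_on_id]]
        continuous_on_compose2[OF continuous_on_imat_entry[of UNIV] continuous_on_snd[OF continuous_on_id]]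
        subset_UNIV)
  then have "?F ` closure (cpsd I \<times> cpsd I) \<subseteq> closure (cpsd I)"
    using cpsd_add closure_subset
    by (intro image_closure_subset) (fastforce simp: image_subset_iff)+
  moreover have "(A, B) \<in> closure (cpsd I \<times> cpsd I)"
    using assms by (simp add: closure_Times)
  ultimately show ?thesis
    by (auto simp: image_subset_iff)
qed

lemma closure_cpsd_scale:
  assumes "A \<in> closure (cpsd I)" "0 \<le> c"
  shows "(\<lambda>p q. c * A p q) \<in> closure (cpsd I)"
proof -
  let ?F = "\<lambda>X p q. c * X p q :: real"
  have "continuous_on S ?F" for S :: "'i imat set"
    by (intro continuous_on_imatI continuous_intros)
  then have "?F ` closure (cpsd I) \<subseteq> closure (cpsd I)"
    using cpsd_scale[OF _ assms(2)] closure_subset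
    by (intro image_closure_subset) (fastforce simp: image_subset_iff)+
  then show ?thesis
    using assms(1) by auto
qed

text \<open>Equations and weak inequalities between entries cut out closed sets, so they pass from
  the cone to its closure. The next three lemmas rest on the same argument.\<close>

lemma closure_cpsd_sym:
  assumes "A \<in> closure (cpsd I)"
  shows "A p q = A q p"
proof -
  have "closed {X. X p q = (X q p :: real)}"
    by (intro closed_Collect_eq continuous_intros)
  moreover have "cpsd I \<subseteq> {X. X p q = X q p}"
    by (auto simp: cpsd_def sym_imats_def)
  ultimately show ?thesis
    using assms closure_minimal by blast
qed

lemma closure_cpsd_diag_nonneg:
  assumes "A \<in> closure (cpsd I)"
  shows "0 \<le> A p p"
proof -
  have "closed {X. 0 \<le> (X p p :: real)}"
    by (intro closed_Collect_le continuous_intros)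
  moreover have "cpsd I \<subseteq> {X. 0 \<le> X p p}"
    using cpsd_diag_nonneg by auto
  ultimately show ?thesis
    using assms closure_minimal by blast
qed

lemma closure_cpsd_Cauchy_Schwarz:
  assumes "A \<in> closure (cpsd I)"
  shows "(A p q)\<^sup>2 \<le> A p p * A q q"
proof -
  have "closed {X. (X p q)\<^sup>2 \<le> (X p p * X q q :: real)}"
    by (intro closed_Collect_le continuous_intros)
  moreover have "cpsd I \<subseteq> {X. (X p q)\<^sup>2 \<le> X p p * X q q}"
    using cpsd_Cauchy_Schwarz by auto
  ultimately show ?thesis
    using assms closure_minimal by blast
qed

lemma closure_cpsd_outside:
  assumes "A \<in> closure (cpsd I)" "p \<notin> I \<or> q \<notin> I"
  shows "A p q = 0"
proof -
  have "closed {X. X p q = (0 :: real)}"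
    by (intro closed_Collect_eq continuous_intros)
  moreover have "cpsd I \<subseteq> {X. X p q = 0}"
    using assms(2) by (auto simp: cpsd_def sym_imats_def)
  ultimately show ?thesis
    using assms(1) closure_minimal by blast
qed

section \<open>The compact base of trace one\<close>

definition cpsd_base :: "'i set \<Rightarrow> 'i imat set" where
  "cpsd_base I = {X \<in> closure (cpsd I). (\<Sum>p\<in>I. X p p) = 1}"

text \<open>Nonnegative diagonal entries with sum 1 are at most 1, and Cauchy-Schwarz then bounds
  all other entries, so the base is a closed subset of a cube.\<close>

lemma compact_cpsd_base:
  assumes "finite I"
  shows "compact (cpsd_base I :: 'i imat set)"
proof -
  \<comment> \<open>Matrices are functions on the whole index type, which may be infinite; the cube
    is compact by Tychonoff's theorem.\<close>
  let ?box = "PiE UNIV (\<lambda>_. PiE UNIV (\<lambda>_. {-1..1})) :: 'i imat set"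
  have "compact (PiE UNIV (\<lambda>_. {-1..1}) :: ('i \<Rightarrow> real) set)"
    unfolding compactin_euclidean_iff[symmetric] euclidean_product_topology[symmetric] compactin_PiE
    by simp
  then have "compact ?box"
    unfolding compactin_euclidean_iff[symmetric] euclidean_product_topology[symmetric]
      compactin_PiE
    by blast
  moreover have "closed (cpsd_base I)"
  proof -
    have "closed {X. (\<Sum>p\<in>I. X p p) = (1 :: real)}"
      by (intro closed_Collect_eq continuous_intros)
    then show ?thesis
      unfolding cpsd_base_def Collect_conj_eq by (simp add: closed_Int)
  qed
  moreover have "cpsd_base I \<subseteq> ?box"
  proof
    fix X assume X: "X \<in> cpsd_base I"
    then have cl: "X \<in> closure (cpsd I)" and tr: "(\<Sum>p\<in>I. X p p) = 1"
      by (simp_all add: cpsd_base_def)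
    have diag: "X p p \<le> 1" for p
    proof (cases "p \<in> I")
      case True
      then show ?thesis
        using member_le_sum[of p I "\<lambda>p. X p p"] closure_cpsd_diag_nonneg[OF cl] tr assms by simp
    next
      case False
      then show ?thesis
        using closure_cpsd_outside[OF cl] by simp
    qed
    have "\<bar>X p q\<bar> \<le> 1" for p q
    proof -
      have "X p p * X q q \<le> 1 * 1"
        by (intro mult_mono diag closure_cpsd_diag_nonneg[OF cl]) simp
      then have "(X p q)\<^sup>2 \<le> 1"
        using closure_cpsd_Cauchy_Schwarz[OF cl, of p q] by simp
      then show ?thesis
        by (simp add: abs_square_le_1)
    qed
    then show "X \<in> ?box"
      by (simp add: PiE_def abs_le_iff minus_le_iff)
  qed
  ultimately show ?thesis
    by (metis compact_Int_closed inf.absorb_iff2)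
qed

lemma imat_inner_scale: "imat_inner I M (\<lambda>p q. c * X p q) = c * imat_inner I M X"
  by (simp add: imat_inner_def sum_distrib_left mult.left_commute)

lemma imat_inner_add:
  "imat_inner I M (\<lambda>p q. X p q + Y p q) = imat_inner I M X + imat_inner I M Y"
  by (simp add: imat_inner_def sum.distrib distrib_left)

lemma continuous_on_imat_inner: "continuous_on S (imat_inner I M)"
  unfolding imat_inner_def by (intro continuous_intros)

text \<open>Every nonzero matrix of the cone has positive trace, so it is a multiple of one in the base.\<close>

lemma imat_inner_nonneg_of_cpsd_base:
  assumes "finite I" and pos: "\<And>X. X \<in> cpsd_base I \<Longrightarrow> 0 \<le> imat_inner I M X"
    and X: "X \<in> cpsd I"
  shows "0 \<le> imat_inner I M X"
proof -
  define s where "s = (\<Sum>p\<in>I. X p p)"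
  have s: "0 \<le> s"
    unfolding s_def using cpsd_diag_nonneg[OF X] by (intro sum_nonneg)
  show ?thesis
  proof (cases "s = 0")
    \<comment> \<open>With trace 0 the diagonal vanishes, and by Cauchy-Schwarz so does every
      entry.\<close>
    case True
    then have "X p p = 0" if "p \<in> I" for p
      using that \<open>finite I\<close> cpsd_diag_nonneg[OF X]
      by (simp add: s_def sum_nonneg_eq_0_iff)
    then have "X p q = 0" if "p \<in> I" for p q
      using cpsd_Cauchy_Schwarz[OF X, of p q] that by simp
    then show ?thesis
      by (simp add: imat_inner_def)
  next
    case False
    let ?Y = "\<lambda>p q. inverse s * X p q"
    have "?Y \<in> closure (cpsd I)"
      using X s by (intro closure_cpsd_scale subsetD[OF closure_subset]) simp_all
    moreover have "(\<Sum>p\<in>I. ?Y p p) = inverse s * s"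
      by (simp only: s_def sum_distrib_left)
    ultimately have "?Y \<in> cpsd_base I"
      using False by (simp add: cpsd_base_def)
    then show ?thesis
      using pos[of ?Y] s False by (simp add: imat_inner_scale[of I M "inverse s" X] zero_le_mult_iff)
  qed
qed

section \<open>Multipliers by penalisation\<close>

text \<open>For large \<open>R\<close> the penalised function \<open>g\<^sub>0 + R \<Sum> g\<^sub>k\<^sup>2\<close> is positive on \<open>K\<close>; the multipliers
  \<open>2 R g\<^sub>k\<close> are read off from the first-order condition at its minimum.\<close>

lemma convexlike_multipliers:
  fixes K :: "'a::topological_space set" and g\<^sub>0 :: "'a \<Rightarrow> real" and g :: "'k \<Rightarrow> 'a \<Rightarrow> real"
  assumes K: "compact K" and J: "finite J"
    and cont0: "continuous_on UNIV g\<^sub>0" and cont: "\<And>k. k \<in> J \<Longrightarrow> continuous_on UNIV (g k)"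
    and conv: "\<And>x y t. x \<in> K \<Longrightarrow> y \<in> K \<Longrightarrow> 0 \<le> t \<Longrightarrow> t \<le> 1 \<Longrightarrow>
      \<exists>z\<in>K. g\<^sub>0 z = (1 - t) * g\<^sub>0 x + t * g\<^sub>0 y \<and> (\<forall>k\<in>J. g k z = (1 - t) * g k x + t * g k y)"
    and pos: "\<And>x. x \<in> K \<Longrightarrow> (\<forall>k\<in>J. g k x = 0) \<Longrightarrow> 0 < g\<^sub>0 x"
  shows "\<exists>y. \<forall>x\<in>K. 0 \<le> g\<^sub>0 x + (\<Sum>k\<in>J. y k * g k x)"
proof (cases "K = {}")
  case True
  then show ?thesis
    by blast
next
  case False
  define Q where "Q x = (\<Sum>k\<in>J. (g k x)\<^sup>2)" for x
  have Q_nonneg: "0 \<le> Q x" for x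
    by (simp add: Q_def sum_nonneg)
  have contQ: "continuous_on UNIV Q"
    unfolding Q_def by (intro continuous_intros cont)
  obtain R where R: "0 \<le> R" and Rpos: "\<And>x. x \<in> K \<Longrightarrow> 0 < g\<^sub>0 x + R * Q x"
  proof (cases "K \<inter> {x. g\<^sub>0 x \<le> 0} = {}")
    case True
    then show ?thesis
      using that[of 0] by (auto simp: not_le[symmetric])
  next
    case ne: False
    have "compact (K \<inter> {x. g\<^sub>0 x \<le> 0})"
      using cont0 by (intro compact_Int_closed K closed_Collect_le continuous_on_const)
    \<comment> \<open>On the compact set where \<open>g\<^sub>0\<close> is not positive,
      \<open>pos\<close> rules out common zeros of the \<open>g k\<close>, so the minimum
      \<open>Q x1\<close> is positive there.\<close>
    then obtain x1 where x1: "x1 \<in> K" "g\<^sub>0 x1 \<le> 0"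
      and min1: "\<And>x. x \<in> K \<Longrightarrow> g\<^sub>0 x \<le> 0 \<Longrightarrow> Q x1 \<le> Q x"
      using continuous_attains_inf[OF _ ne continuous_on_subset[OF contQ]] by auto
    obtain x2 where min2: "\<And>x. x \<in> K \<Longrightarrow> g\<^sub>0 x2 \<le> g\<^sub>0 x"
      using continuous_attains_inf[OF K False continuous_on_subset[OF cont0]] by auto
    have "Q x1 \<noteq> 0"
      using pos[OF x1(1)] x1(2) J by (auto simp: Q_def sum_nonneg_eq_0_iff)
    then have q: "0 < Q x1"
      using Q_nonneg[of x1] by simp
    \<comment> \<open>Chosen so that the penalty is at least
      \<open>\<bar>g\<^sub>0 x2\<bar> + 1\<close> wherever \<open>g\<^sub>0 \<le> 0\<close>, which
      outweighs the minimum \<open>g\<^sub>0 x2\<close> of \<open>g\<^sub>0\<close> on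
      \<open>K\<close>.\<close>
    define R where "R = (\<bar>g\<^sub>0 x2\<bar> + 1) / Q x1"
    have R: "0 \<le> R"
      using q by (simp add: R_def)
    have "0 < g\<^sub>0 x + R * Q x" if x: "x \<in> K" for x
    proof (cases "g\<^sub>0 x \<le> 0")
      case True
      have "\<bar>g\<^sub>0 x2\<bar> + 1 = R * Q x1"
        using q by (simp add: R_def)
      also have "\<dots> \<le> R * Q x"
        by (intro mult_left_mono min1 x True R)
      finally show ?thesis
        using min2[OF x] by linarith
    next
      case False
      then show ?thesis
        using R Q_nonneg[of x] by (simp add: add_pos_nonneg)
    qed
    then show ?thesis
      using that R by blast
  qed
  have "continuous_on K (\<lambda>x. g\<^sub>0 x + R * Q x)"
    by (intro continuous_intros continuous_on_subset[OF cont0] continuous_on_subset[OF contQ]) auto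
  then obtain w where w: "w \<in> K" and min: "\<And>x. x \<in> K \<Longrightarrow> g\<^sub>0 w + R * Q w \<le> g\<^sub>0 x + R * Q x"
    using continuous_attains_inf[OF K False] by blast
  have "0 \<le> g\<^sub>0 x + (\<Sum>k\<in>J. (2 * R * g k w) * g k x)" if x: "x \<in> K" for x
  proof -
    \<comment> \<open>Along the segment from \<open>w\<close> to \<open>x\<close> the penalised
      function is a quadratic polynomial in \<open>t\<close>: \<open>D\<close> is its slope at
      \<open>w\<close> and \<open>c\<close> its second-order coefficient.\<close>
    define h where "h k = g k x - g k w" for k
    define D where "D = g\<^sub>0 x - g\<^sub>0 w + 2 * R * (\<Sum>k\<in>J. g k w * h k)"
    define c where "c = R * (\<Sum>k\<in>J. (h k)\<^sup>2)"
    have c: "0 \<le> c"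
      unfolding c_def using R by (intro mult_nonneg_nonneg sum_nonneg) auto
    have slope: "0 \<le> D + t * c" if t: "0 < t" "t \<le> 1" for t
    proof -
      obtain z where z: "z \<in> K" "g\<^sub>0 z = (1 - t) * g\<^sub>0 w + t * g\<^sub>0 x"
        "\<And>k. k \<in> J \<Longrightarrow> g k z = (1 - t) * g k w + t * g k x"
        using conv[OF w x, of t] t by auto
      have "Q z = (\<Sum>k\<in>J. (g k w)\<^sup>2 + 2 * t * (g k w * h k) + t * t * (h k)\<^sup>2)"
        unfolding Q_def
        by (intro sum.cong refl) (simp add: z(3) h_def power2_eq_square algebra_simps)
      also have "\<dots> = Q w + 2 * t * (\<Sum>k\<in>J. g k w * h k) + t * t * (\<Sum>k\<in>J. (h k)\<^sup>2)"
        by (simp add: Q_def sum.distrib sum_distrib_left)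
      finally have "R * Q z = R * Q w + t * (2 * R * (\<Sum>k\<in>J. g k w * h k)) + t * (t * c)"
        by (simp add: c_def algebra_simps)
      then have "g\<^sub>0 z + R * Q z = g\<^sub>0 w + R * Q w + t * (D + t * c)"
        by (simp add: z(2) D_def algebra_simps)
      then have "0 \<le> t * (D + t * c)"
        using min[OF z(1)] by linarith
      then show ?thesis
        using t(1) by (simp add: zero_le_mult_iff)
    qed
    have "0 \<le> D"
    proof (rule ccontr)
      assume D: "\<not> 0 \<le> D"
      \<comment> \<open>A step so short that \<open>t * c \<le> - D / 2\<close>, whence
        \<open>D + t * c < 0\<close>; \<open>c + 1\<close> avoids division by 0.\<close>
      define t where "t = min 1 (- D / (2 * (c + 1)))"
      have t: "0 < t" "t \<le> 1"
        using D c by (auto simp: t_def intro!: divide_neg_pos)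
      have "t * c \<le> (- D / (2 * (c + 1))) * (c + 1)"
        using D c by (intro mult_mono) (auto simp: t_def intro!: divide_nonpos_pos)
      also have "\<dots> = - D / 2"
        using c by (simp add: field_simps)
      finally show False
        using slope[OF t] D by linarith
    qed
    \<comment> \<open>Rearranged, \<open>0 \<le> D\<close> bounds the target below by the penalised
      value at \<open>w\<close> plus \<open>R * Q w\<close>; the former is positive by
      \<open>Rpos\<close>.\<close>
    moreover have "(\<Sum>k\<in>J. g k w * h k) = (\<Sum>k\<in>J. g k w * g k x) - Q w"
      by (simp add: h_def Q_def right_diff_distrib sum_subtractf power2_eq_square)
    moreover have "(\<Sum>k\<in>J. (2 * R * g k w) * g k x) = 2 * R * (\<Sum>k\<in>J. g k w * g k x)"
      by (simp add: sum_distrib_left mult.assoc)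
    moreover have "0 \<le> R * Q w"
      using R Q_nonneg by simp
    ultimately show ?thesis
      using Rpos[OF w] by (simp add: D_def right_diff_distrib)
  qed
  then show ?thesis
    by (intro exI[of _ "\<lambda>k. 2 * R * g k w"] ballI)
qed

lemma cpsd_base_convex:
  assumes "X \<in> cpsd_base I" "Y \<in> cpsd_base I" "0 \<le> t" "t \<le> 1"
  shows "(\<lambda>p q. (1 - t) * X p q + t * Y p q) \<in> cpsd_base I"
  using assms closure_cpsd_add[OF closure_cpsd_scale[of X I "1 - t"] closure_cpsd_scale[of Y I t]]
  by (simp add: cpsd_base_def sum.distrib sum_distrib_left[symmetric])

section \<open>The matrices of the program\<close>

lemma sym_imats_commute: "M \<in> sym_imats I \<Longrightarrow> M p q = M q p"
  by (simp only: sym_imats_def mem_Collect_eq)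

lemma sym_imats_outside: "M \<in> sym_imats I \<Longrightarrow> p \<notin> I \<or> q \<notin> I \<Longrightarrow> M p q = 0"
  by (simp only: sym_imats_def mem_Collect_eq)

lemma imat_inner_diff_left:
  "imat_inner I (\<lambda>p q. M p q - N p q) X = imat_inner I M X - imat_inner I N X"
  by (simp add: imat_inner_def left_diff_distrib sum_subtractf)

lemma imat_inner_add_left:
  "imat_inner I (\<lambda>p q. M p q + N p q) X = imat_inner I M X + imat_inner I N X"
  by (simp add: imat_inner_def distrib_right sum.distrib)

lemma imat_inner_scale_left: "imat_inner I (\<lambda>p q. c * M p q) X = c * imat_inner I M X"
  by (simp add: imat_inner_def sum_distrib_left mult.assoc)

lemma imat_inner_sum_left:
  "imat_inner I (\<lambda>p q. \<Sum>k\<in>J. M k p q) X = (\<Sum>k\<in>J. imat_inner I (M k) X)"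
proof (induction J rule: infinite_finite_induct)
  case (insert k J)
  then show ?case
    by (simp add: imat_inner_add_left)
qed (simp_all add: imat_inner_def)

section \<open>Inner products with block matrices\<close>

lemma finite_block_indices: "finite (verts G) \<Longrightarrow> finite (block_indices G t)"
  by (simp add: block_indices_def)

lemma finite_indices: "finite (verts G) \<Longrightarrow> finite (indices G)"
  by (simp add: indices_def finite_block_indices)

lemma imat_inner_direct_sum:
  assumes fin: "finite (verts G)"
  shows "imat_inner (indices G) (direct_sum G M) X =
    (\<Sum>t=1..card (verts G). \<Sum>a\<in>block_indices G t. \<Sum>b\<in>block_indices G t.
       M t a b * X (t, b) (t, a))"
proof -
  have inner: "(\<Sum>q\<in>indices G. direct_sum G M (t, a) q * X q (t, a)) =
      (\<Sum>b\<in>block_indices G t. M t a b * X (t, b) (t, a))" if t: "t \<in> {1..card (verts G)}" for t a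
  proof -
    have "(\<Sum>q\<in>indices G. direct_sum G M (t, a) q * X q (t, a)) =
        (\<Sum>s=1..card (verts G). \<Sum>b\<in>block_indices G s.
           direct_sum G M (t, a) (s, b) * X (s, b) (t, a))"
      unfolding indices_def using fin by (subst sum.Sigma) (simp_all add: finite_block_indices)
    \<comment> \<open>For a row in block \<open>t\<close>, columns in other blocks contribute
      0.\<close>
    also have "\<dots> = (\<Sum>s=1..card (verts G). if s = t
        then \<Sum>b\<in>block_indices G t. M t a b * X (t, b) (t, a) else 0)"
      using t by (intro sum.cong refl) (auto simp: direct_sum_def)
    finally show ?thesis
      using t by (simp add: sum.delta)
  qed
  have "imat_inner (indices G) (direct_sum G M) X =
      (\<Sum>t=1..card (verts G). \<Sum>a\<in>block_indices G t.
         \<Sum>q\<in>indices G. direct_sum G M (t, a) q * X q (t, a))"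
    unfolding imat_inner_def
    by (subst (1) indices_def, subst sum.Sigma) (simp_all add: fin finite_block_indices case_prod_unfold)
  also have "\<dots> = (\<Sum>t=1..card (verts G). \<Sum>a\<in>block_indices G t. \<Sum>b\<in>block_indices G t.
      M t a b * X (t, b) (t, a))"
    by (intro sum.cong refl inner)
  finally show ?thesis .
qed

lemma sum_elem_sym_None:
  assumes fin: "finite (verts G)"
  shows "(\<Sum>a\<in>block_indices G t. \<Sum>b\<in>block_indices G t. elem_sym None None a b * f b a) =
    (f None None :: real)"
proof -
  have "(\<Sum>a\<in>block_indices G t. \<Sum>b\<in>block_indices G t. elem_sym None None a b * f b a) =
      (\<Sum>a\<in>block_indices G t. if a = None then
        \<Sum>b\<in>block_indices G t. if b = None then f None None else 0 else 0)"
    by (intro sum.cong refl) (auto simp: elem_sym_def intro!: sum.cong)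
  then show ?thesis
    using finite_block_indices[OF fin, of t] by (simp add: sum.delta block_indices_def)
qed

lemma imat_inner_mat_B:
  assumes "finite (verts G)"
  shows "imat_inner (indices G) (mat_B G) X = (\<Sum>t=1..card (verts G). X (t, None) (t, None))"
  unfolding mat_B_def imat_inner_direct_sum[OF assms]
  by (intro sum.cong refl) (rule sum_elem_sym_None[OF assms])

text \<open>The two unit entries pick out \<open>X q p\<close> and \<open>X p q\<close>. For
  \<open>p = q\<close> they would coincide and be counted once.\<close>

lemma imat_inner_elem:
  assumes "finite I" "p \<in> I" "q \<in> I" "p \<noteq> q"
  shows "imat_inner I (elem_sym p q) X = X p q + X q p"
proof -
  have "imat_inner I (elem_sym p q) X =
      (\<Sum>r\<in>I. (if r = p then X q p else 0) + (if r = q then X p q else 0))"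
    unfolding imat_inner_def
  proof (intro sum.cong refl)
    fix r
    have "(\<Sum>s\<in>I. elem_sym p q r s * X s r) =
        (\<Sum>s\<in>I. (if s = q then (if r = p then X q p else 0) else 0)
          + (if s = p then (if r = q then X p q else 0) else 0))"
      using assms(4) by (intro sum.cong refl) (auto simp: elem_sym_def)
    then show "(\<Sum>s\<in>I. elem_sym p q r s * X s r) =
        (if r = p then X q p else 0) + (if r = q then X p q else 0)"
      using assms by (simp add: sum.distrib)
  qed
  then show ?thesis
    using assms by (simp add: sum.distrib)
qed

text \<open>With this, the constraint matrices can be handled without reference to blocks.\<close>

lemma mat_E_eq_elem_sym: "mat_E t a b = elem_sym (t, a) (t, b)"
  by (auto simp: mat_E_def block_ext_def elem_sym_def fun_eq_iff)

lemma direct_sum_sym_imats: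
  assumes "\<And>t a b. M t a b = M t b a"
    and "\<And>t a b. a \<notin> block_indices G t \<Longrightarrow> M t a b = 0"
  shows "direct_sum G M \<in> sym_imats (indices G)"
proof -
  have outside: "M t a b = 0" if "b \<notin> block_indices G t" for t a b
    using assms(1)[of t a b] assms(2)[OF that] by simp
  show ?thesis
    by (auto simp: sym_imats_def direct_sum_def indices_def outside assms(2) intro: assms(1))
qed

lemma elem_sym_sym_imats: "p \<in> I \<Longrightarrow> q \<in> I \<Longrightarrow> elem_sym p q \<in> sym_imats I"
  by (auto simp: sym_imats_def elem_sym_def)

lemma mat_B_sym_imats: "mat_B G \<in> sym_imats (indices G)"
  unfolding mat_B_def by (rule direct_sum_sym_imats) (auto simp: elem_sym_def block_indices_def)

lemma mat_C_sym_imats: "mat_C G \<in> sym_imats (indices G)"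
  unfolding mat_C_def by (rule direct_sum_sym_imats) (auto simp: elem_sym_def block_indices_def)

lemma mat_A_sym_imats: "mat_A G \<in> sym_imats (indices G)"
  unfolding mat_A_def
proof (rule direct_sum_sym_imats)
  show "(\<Sum>u\<in>verts G. mat_A_vertex t u a b) = (\<Sum>u\<in>verts G. mat_A_vertex t u b a)" for t a b
    by (intro sum.cong refl) (auto simp: mat_A_vertex_def split: option.split)
  show "(\<Sum>u\<in>verts G. mat_A_vertex t u a b) = 0" if "a \<notin> block_indices G t" for t a b
    using that
    by (intro sum.neutral ballI) (auto simp: mat_A_vertex_def block_indices_def split: option.split)
qed


text \<open>\<^const>\<open>None\<close> indexes \<open>A\<close>; a left summand stands for \<open>(t, i, u, v)\<close> with \<open>u\<close>, \<open>v\<close> adjacent, a right one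
  for \<open>(t, i, j, u)\<close> with \<open>i \<noteq> j\<close>.\<close>

type_synonym 'v cidx = "(nat \<times> nat \<times> 'v \<times> 'v + nat \<times> nat \<times> nat \<times> 'v) option"

definition edge_cidx :: "('v, 'e) pre_digraph \<Rightarrow> (nat \<times> nat \<times> 'v \<times> 'v) set" where
  "edge_cidx G = (SIGMA t:{1..card (verts G)}. {1..t} \<times> arcs_ends G)"

definition colour_cidx :: "('v, 'e) pre_digraph \<Rightarrow> (nat \<times> nat \<times> nat \<times> 'v) set" where
  "colour_cidx G = (SIGMA t:{1..card (verts G)}. SIGMA i:{1..t}. ({1..t} - {i}) \<times> verts G)"

definition cidx :: "('v, 'e) pre_digraph \<Rightarrow> 'v cidx set" where
  "cidx G = insert None (Some ` (edge_cidx G <+> colour_cidx G))"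

text \<open>All homogeneous constraints form one finite family, as
  \<open>convexlike_multipliers\<close> expects. The normalisation by \<open>mat_B\<close> is
  absent: it enters through the term \<open>l * mat_B\<close> of the objective.\<close>

definition constraint_mat :: "('v, 'e) pre_digraph \<Rightarrow> 'v cidx \<Rightarrow> 'v idx imat" where
  "constraint_mat G k = (case k of
       None \<Rightarrow> mat_A G
     | Some (Inl (t, i, u, v)) \<Rightarrow> mat_E t (Some (u, i)) (Some (v, i))
     | Some (Inr (t, i, j, u)) \<Rightarrow> mat_E t (Some (u, i)) (Some (u, j)))"

section \<open>Duality for the program of a graph\<close>

context graph
begin

lemma finite_arcs_ends: "finite (arcs_ends G)"
  by (simp add: arcs_ends_conv)

lemma finite_edge_cidx: "finite (edge_cidx G)"
  by (simp add: edge_cidx_def finite_arcs_ends)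

lemma finite_colour_cidx: "finite (colour_cidx G)"
  by (simp add: colour_cidx_def)

lemma finite_cidx: "finite (cidx G)"
  by (simp add: cidx_def finite_edge_cidx finite_colour_cidx)

lemma constraint_mat_sym_imats:
  assumes "k \<in> cidx G"
  shows "constraint_mat G k \<in> sym_imats (indices G)"
proof -
  have entry: "(t, Some (u, i)) \<in> indices G"
    if "t \<in> {1..card (verts G)}" "i \<in> {1..t}" "u \<in> verts G" for t u i
    using that by (auto simp: indices_def block_indices_def)
  show ?thesis
    using assms adj_in_verts mat_A_sym_imats[of G]
    by (auto simp: cidx_def edge_cidx_def colour_cidx_def constraint_mat_def mat_E_eq_elem_sym
        intro!: elem_sym_sym_imats entry)
qed

text \<open>\<open>dual_slack\<close> subtracts its multipliers, while the multiplier lemma adds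
  them; hence the minus signs. The rest is splitting the sum over \<open>cidx G\<close> by kind of
  constraint.\<close>

lemma dual_slack_eq:
  "dual_slack G l (- y None) (\<lambda>t u v i. - y (Some (Inl (t, i, u, v))))
     (\<lambda>t u i j. - y (Some (Inr (t, i, j, u)))) =
   (\<lambda>p q. mat_C G p q - l * mat_B G p q + (\<Sum>k\<in>cidx G. y k * constraint_mat G k p q))"
proof (intro ext)
  fix p q
  define f where "f k = y k * constraint_mat G k p q" for k
  have f_inl: "f (Some (Inl (t, i, u, v))) =
      y (Some (Inl (t, i, u, v))) * mat_E t (Some (u, i)) (Some (v, i)) p q" for t i u v
    by (simp only: f_def constraint_mat_def option.case sum.case prod.case)
  have f_inr: "f (Some (Inr (t, i, j, u))) =
      y (Some (Inr (t, i, j, u))) * mat_E t (Some (u, i)) (Some (u, j)) p q" for t i j u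
    by (simp only: f_def constraint_mat_def option.case sum.case prod.case)
  have f_None: "f None = y None * mat_A G p q"
    by (simp only: f_def constraint_mat_def option.case)
  have "(\<Sum>k\<in>cidx G. f k) = f None + ((\<Sum>k\<in>edge_cidx G. f (Some (Inl k)))
      + (\<Sum>k\<in>colour_cidx G. f (Some (Inr k))))"
    unfolding cidx_def using finite_edge_cidx finite_colour_cidx
    by (simp add: sum.reindex sum.Plus)
  moreover have "(\<Sum>t=1..card (verts G). \<Sum>i=1..t. \<Sum>(u, v)\<in>arcs_ends G.
      f (Some (Inl (t, i, u, v)))) = (\<Sum>k\<in>edge_cidx G. f (Some (Inl k)))"
    unfolding edge_cidx_def sum.cartesian_product
    by (subst sum.Sigma) (auto simp: finite_arcs_ends intro!: sum.cong)
  moreover have "(\<Sum>t=1..card (verts G). \<Sum>i=1..t. \<Sum>j\<in>{1..t} - {i}. \<Sum>u\<in>verts G.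
      f (Some (Inr (t, i, j, u)))) = (\<Sum>k\<in>colour_cidx G. f (Some (Inr k)))"
  proof -
    have "(\<Sum>i=1..t. \<Sum>j\<in>{1..t} - {i}. \<Sum>u\<in>verts G. f (Some (Inr (t, i, j, u)))) =
        (\<Sum>x\<in>(SIGMA i:{1..t}. ({1..t} - {i}) \<times> verts G). f (Some (Inr (t, x))))" for t
      unfolding sum.cartesian_product by (subst sum.Sigma) (auto intro!: sum.cong)
    then show ?thesis
      unfolding colour_cidx_def by (simp only:) (subst sum.Sigma, auto intro!: sum.cong)
  qed
  moreover have "dual_slack G l (- y None) (\<lambda>t u v i. - y (Some (Inl (t, i, u, v))))
      (\<lambda>t u i j. - y (Some (Inr (t, i, j, u)))) p q =
    mat_C G p q - l * mat_B G p q + (f None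
      + ((\<Sum>t=1..card (verts G). \<Sum>i=1..t. \<Sum>(u, v)\<in>arcs_ends G. f (Some (Inl (t, i, u, v))))
      + (\<Sum>t=1..card (verts G). \<Sum>i=1..t. \<Sum>j\<in>{1..t} - {i}. \<Sum>u\<in>verts G.
          f (Some (Inr (t, i, j, u))))))"
    unfolding dual_slack_def f_inl f_inr f_None mult_minus_left case_prod_unfold sum_negf
    by (simp only: diff_minus_eq_add add.assoc)
  ultimately show "dual_slack G l (- y None) (\<lambda>t u v i. - y (Some (Inl (t, i, u, v))))
      (\<lambda>t u i j. - y (Some (Inr (t, i, j, u)))) p q =
      mat_C G p q - l * mat_B G p q + (\<Sum>k\<in>cidx G. y k * constraint_mat G k p q)"
    unfolding f_def[symmetric] by (simp only:)
qed

text \<open>Away from the index \<open>None\<close>, a block of \<open>mat_A\<close> has an all-ones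
  block for each vertex and zeros between different vertices. The colour constraints kill the
  off-diagonal part of \<open>X\<close> in the former, so only the diagonal of \<open>X\<close>
  remains.\<close>

lemma imat_inner_mat_A_eq_trace:
  assumes zero: "\<And>t p. t \<in> {1..card (verts G)} \<Longrightarrow> X p (t, None) = 0 \<and> X (t, None) p = 0"
    and colour: "\<And>t i j u. t \<in> {1..card (verts G)} \<Longrightarrow> i \<in> {1..t} \<Longrightarrow> j \<in> {1..t} \<Longrightarrow> u \<in> verts G \<Longrightarrow>
      i \<noteq> j \<Longrightarrow> X (t, Some (u, i)) (t, Some (u, j)) = 0"
  shows "imat_inner (indices G) (mat_A G) X = (\<Sum>p\<in>indices G. X p p)"
proof -
  have entry: "(\<Sum>u\<in>verts G. mat_A_vertex t u a b) * X (t, b) (t, a) =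
      (if b = a then X (t, a) (t, a) else 0)"
    if t: "t \<in> {1..card (verts G)}" and a: "a \<in> block_indices G t" and b: "b \<in> block_indices G t"
    for t a b
  proof (cases "a = None \<or> b = None")
    case True
    then show ?thesis
      using zero[OF t] by auto
  next
    case False
    then obtain v i w j where ab: "a = Some (v, i)" "b = Some (w, j)"
      by (metis not_None_eq surj_pair)
    have mem: "v \<in> verts G" "w \<in> verts G" "i \<in> {1..t}" "j \<in> {1..t}"
      using a b by (auto simp: ab block_indices_def)
    have "(\<Sum>u\<in>verts G. mat_A_vertex t u a b) = (\<Sum>u\<in>verts G. if u = v then of_bool (v = w) else 0)"
      using mem by (intro sum.cong) (auto simp: mat_A_vertex_def ab)
    then have "(\<Sum>u\<in>verts G. mat_A_vertex t u a b) = of_bool (v = w)"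
      using mem by simp
    then show ?thesis
      using colour[OF t mem(4,3) mem(1)] by (auto simp: ab)
  qed
  have "imat_inner (indices G) (mat_A G) X = (\<Sum>t=1..card (verts G). \<Sum>a\<in>block_indices G t.
      \<Sum>b\<in>block_indices G t. if b = a then X (t, a) (t, a) else 0)"
    unfolding mat_A_def imat_inner_direct_sum[OF finite_verts]
    by (intro sum.cong refl entry)
  also have "\<dots> = (\<Sum>t=1..card (verts G). \<Sum>a\<in>block_indices G t. X (t, a) (t, a))"
    by (simp add: finite_block_indices)
  also have "\<dots> = (\<Sum>p\<in>indices G. X p p)"
    unfolding indices_def
    by (subst sum.Sigma) (simp_all add: finite_block_indices case_prod_unfold)
  finally show ?thesis .
qed

text \<open>By symmetry of \<open>X\<close> the inner product with the elementary matrix is twice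
  the entry.\<close>

lemma constraint_mat_colour:
  assumes X: "X \<in> closure (cpsd (indices G))"
    and zero: "\<forall>k\<in>cidx G. imat_inner (indices G) (constraint_mat G k) X = 0"
    and t: "t \<in> {1..card (verts G)}" and ij: "i \<in> {1..t}" "j \<in> {1..t}" "i \<noteq> j" and u: "u \<in> verts G"
  shows "X (t, Some (u, i)) (t, Some (u, j)) = 0"
proof -
  have k: "Some (Inr (t, i, j, u)) \<in> cidx G"
    using t ij u by (auto simp: cidx_def colour_cidx_def)
  have "(t, Some (u, i)) \<in> indices G" "(t, Some (u, j)) \<in> indices G"
    using t ij u by (auto simp: indices_def block_indices_def)
  then have "imat_inner (indices G) (constraint_mat G (Some (Inr (t, i, j, u)))) X =
      2 * X (t, Some (u, i)) (t, Some (u, j))"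
    using ij(3) closure_cpsd_sym[OF X, of "(t, Some (u, j))"]
    by (simp add: constraint_mat_def mat_E_eq_elem_sym imat_inner_elem finite_indices)
  then show ?thesis
    using zero k by simp
qed

text \<open>If \<open>\<langle>B, X\<rangle> = 0\<close> then the rows of \<open>X\<close> indexed by \<open>0\<close> vanish, and the constraints turn
  \<open>\<langle>A, X\<rangle>\<close> into the trace.\<close>

lemma imat_inner_mat_B_pos:
  assumes base: "X \<in> cpsd_base (indices G)"
    and zero: "\<forall>k\<in>cidx G. imat_inner (indices G) (constraint_mat G k) X = 0"
  shows "0 < imat_inner (indices G) (mat_B G) X"
proof (rule ccontr)
  assume neg: "\<not> 0 < imat_inner (indices G) (mat_B G) X"
  have X: "X \<in> closure (cpsd (indices G))" and tr: "(\<Sum>p\<in>indices G. X p p) = 1"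
    using base by (simp_all add: cpsd_base_def)
  have nonneg: "0 \<le> X p p" for p
    by (rule closure_cpsd_diag_nonneg[OF X])
  have "(\<Sum>t=1..card (verts G). X (t, None) (t, None)) = 0"
    using neg unfolding imat_inner_mat_B[OF finite_verts] not_less
    by (intro antisym sum_nonneg nonneg)
  then have diag: "X (t, None) (t, None) = 0" if "t \<in> {1..card (verts G)}" for t
    using that nonneg by (subst (asm) sum_nonneg_eq_0_iff) auto
  \<comment> \<open>A zero diagonal entry annihilates its whole column by Cauchy-Schwarz.\<close>
  have col: "X p (t, None) = 0" if "t \<in> {1..card (verts G)}" for p t
    using closure_cpsd_Cauchy_Schwarz[OF X, of p "(t, None)"] diag[OF that] by simp
  have "imat_inner (indices G) (mat_A G) X = (\<Sum>p\<in>indices G. X p p)"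
    using col closure_cpsd_sym[OF X] constraint_mat_colour[OF X zero]
    by (intro imat_inner_mat_A_eq_trace) metis+
  moreover have "None \<in> cidx G"
    by (simp add: cidx_def)
  ultimately show False
    using bspec[OF zero, of None] tr by (simp add: constraint_mat_def)
qed

text \<open>The constraints and the closed cone are invariant under positive scaling, so dividing by
  the inner product with \<open>mat_B\<close> gives a feasible point.\<close>

lemma chi_q_feasible_normalize:
  assumes X: "X \<in> closure (cpsd (indices G))"
    and zero: "\<forall>k\<in>cidx G. imat_inner (indices G) (constraint_mat G k) X = 0"
    and pos: "0 < imat_inner (indices G) (mat_B G) X"
  shows "(\<lambda>p q. inverse (imat_inner (indices G) (mat_B G) X) * X p q) \<in> chi_q_feasible G"
proof -
  have edge: "imat_inner (indices G) (mat_E t (Some (u, i)) (Some (v, i))) X = 0"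
    if "t \<in> {1..card (verts G)}" "i \<in> {1..t}" "u \<rightarrow> v" for t i u v
  proof -
    have "Some (Inl (t, i, u, v)) \<in> cidx G"
      using that by (auto simp: cidx_def edge_cidx_def)
    from bspec[OF zero this] show ?thesis
      by (simp add: constraint_mat_def)
  qed
  have colour: "imat_inner (indices G) (mat_E t (Some (u, i)) (Some (u, j))) X = 0"
    if "t \<in> {1..card (verts G)}" "i \<in> {1..t}" "j \<in> {1..t}" "u \<in> verts G" "i \<noteq> j" for t i j u
  proof -
    have "Some (Inr (t, i, j, u)) \<in> cidx G"
      using that by (auto simp: cidx_def colour_cidx_def)
    from bspec[OF zero this] show ?thesis
      by (simp add: constraint_mat_def)
  qed
  have "None \<in> cidx G"
    by (simp add: cidx_def)
  from bspec[OF zero this] have "imat_inner (indices G) (mat_A G) X = 0"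
    by (simp add: constraint_mat_def)
  then show ?thesis
    unfolding chi_q_feasible_def mem_Collect_eq imat_inner_scale
    using pos edge colour closure_cpsd_scale[OF X, of "inverse (imat_inner (indices G) (mat_B G) X)"]
    by (intro conjI ballI allI impI) simp_all
qed

text \<open>Duality with a strict gap: the compact base takes the place of an interior point, and
  the strict inequality in \<open>l\<close> supplies the positivity required by
  \<open>convexlike_multipliers\<close>.\<close>

lemma lower_bound_certificate:
  assumes l: "ereal l < chi_q_tilde G"
  obtains m y z where "dual_slack G l m y z \<in> sym_imats (indices G)"
    and "\<And>X. X \<in> cpsd (indices G) \<Longrightarrow> 0 \<le> imat_inner (indices G) (dual_slack G l m y z) X"
proof -
  define I where "I = indices G"
  define g\<^sub>0 where "g\<^sub>0 X = imat_inner I (mat_C G) X - l * imat_inner I (mat_B G) X" for X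
  define g where "g k = imat_inner I (constraint_mat G k)" for k
  have fin: "finite I"
    by (simp add: I_def finite_indices)
  have "\<exists>y. \<forall>X\<in>cpsd_base I. 0 \<le> g\<^sub>0 X + (\<Sum>k\<in>cidx G. y k * g k X)"
  proof (rule convexlike_multipliers)
    show "compact (cpsd_base I)"
      by (rule compact_cpsd_base[OF fin])
    show "finite (cidx G)"
      by (rule finite_cidx)
    show "continuous_on UNIV g\<^sub>0"
      unfolding g\<^sub>0_def by (intro continuous_intros continuous_on_imat_inner)
    show "continuous_on UNIV (g k)" for k
      unfolding g_def by (rule continuous_on_imat_inner)
    show "\<exists>Z\<in>cpsd_base I. g\<^sub>0 Z = (1 - t) * g\<^sub>0 X + t * g\<^sub>0 Y \<and>
        (\<forall>k\<in>cidx G. g k Z = (1 - t) * g k X + t * g k Y)"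
      if "X \<in> cpsd_base I" "Y \<in> cpsd_base I" "0 \<le> t" "t \<le> 1" for X Y t
    proof (rule bexI[OF _ cpsd_base_convex[OF that]])
      have lin: "imat_inner I M (\<lambda>p q. (1 - t) * X p q + t * Y p q) =
          (1 - t) * imat_inner I M X + t * imat_inner I M Y" for M
        by (simp only: imat_inner_add[of I M "\<lambda>p q. (1 - t) * X p q" "\<lambda>p q. t * Y p q"]
            imat_inner_scale)
      show "g\<^sub>0 (\<lambda>p q. (1 - t) * X p q + t * Y p q) = (1 - t) * g\<^sub>0 X + t * g\<^sub>0 Y \<and>
          (\<forall>k\<in>cidx G. g k (\<lambda>p q. (1 - t) * X p q + t * Y p q) = (1 - t) * g k X + t * g k Y)"
        unfolding g\<^sub>0_def g_def lin by (simp add: algebra_simps)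
    qed
    show "0 < g\<^sub>0 X" if X: "X \<in> cpsd_base I" and zero: "\<forall>k\<in>cidx G. g k X = 0" for X
    proof -
      \<comment> \<open>After division by \<open>b\<close> the matrix is feasible, so its objective
        value exceeds \<open>l\<close>; multiplying back by \<open>b > 0\<close> gives the
        claim.\<close>
      define b where "b = imat_inner I (mat_B G) X"
      have b: "0 < b"
        using imat_inner_mat_B_pos X zero by (simp add: b_def g_def I_def)
      have "(\<lambda>p q. inverse b * X p q) \<in> chi_q_feasible G"
        using chi_q_feasible_normalize[of X] X zero b
        by (simp add: b_def g_def I_def cpsd_base_def)
      then have "chi_q_tilde G \<le> ereal (imat_inner I (mat_C G) (\<lambda>p q. inverse b * X p q))"
        unfolding chi_q_tilde_def I_def by (rule INF_lower)
      with l have "l < inverse b * imat_inner I (mat_C G) X"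
        unfolding imat_inner_scale by (metis ereal_less(2) less_ereal.simps(1) less_le_trans)
      then show ?thesis
        using b by (simp add: g\<^sub>0_def b_def[symmetric] field_simps)
    qed
  qed
  then obtain y where y: "\<And>X. X \<in> cpsd_base I \<Longrightarrow> 0 \<le> g\<^sub>0 X + (\<Sum>k\<in>cidx G. y k * g k X)"
    by blast
  let ?M = "dual_slack G l (- y None) (\<lambda>t u v i. - y (Some (Inl (t, i, u, v))))
    (\<lambda>t u i j. - y (Some (Inr (t, i, j, u))))"
  have "imat_inner I ?M X = g\<^sub>0 X + (\<Sum>k\<in>cidx G. y k * g k X)" for X
    unfolding dual_slack_eq g\<^sub>0_def g_def
    by (simp only: imat_inner_add_left imat_inner_diff_left imat_inner_scale_left imat_inner_sum_left)
  then have "0 \<le> imat_inner I ?M X" if "X \<in> cpsd_base I" for X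
    using y[OF that] by simp
  then have "0 \<le> imat_inner I ?M X" if "X \<in> cpsd I" for X
    using imat_inner_nonneg_of_cpsd_base[OF fin _ that] by blast
  moreover have "?M \<in> sym_imats I"
    unfolding dual_slack_eq sym_imats_def
  proof (intro CollectI conjI allI impI)
    fix p q
    have "constraint_mat G k p q = constraint_mat G k q p" if "k \<in> cidx G" for k
      by (rule sym_imats_commute[OF constraint_mat_sym_imats[OF that]])
    moreover have "mat_B G p q = mat_B G q p" "mat_C G p q = mat_C G q p"
      by (rule sym_imats_commute[OF mat_B_sym_imats] sym_imats_commute[OF mat_C_sym_imats])+
    ultimately show "mat_C G p q - l * mat_B G p q + (\<Sum>k\<in>cidx G. y k * constraint_mat G k p q) =
        mat_C G q p - l * mat_B G q p + (\<Sum>k\<in>cidx G. y k * constraint_mat G k q p)"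
      by (simp cong: sum.cong)
  next
    fix p q assume pq: "p \<notin> I \<or> q \<notin> I"
    have "constraint_mat G k p q = 0" if "k \<in> cidx G" for k
      using pq unfolding I_def by (rule sym_imats_outside[OF constraint_mat_sym_imats[OF that]])
    moreover have "mat_B G p q = 0" "mat_C G p q = 0"
      using sym_imats_outside[OF mat_B_sym_imats] sym_imats_outside[OF mat_C_sym_imats] pq
      unfolding I_def by blast+
    ultimately show "mat_C G p q - l * mat_B G p q + (\<Sum>k\<in>cidx G. y k * constraint_mat G k p q) = 0"
      by simp
  qed
  ultimately show ?thesis
    using that unfolding I_def by blast
qed

end

theorem lemma4p19:
  fixes G :: "('v, 'e) pre_digraph"
  assumes "Connes_embedding"
    and "graph G" and "verts G \<noteq> {}"
  shows "chi_q_tilde G \<le> (INF \<epsilon>\<in>{0<..}. Psi \<epsilon> G)"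
proof (rule INF_greatest, rule ccontr)
  interpret graph G
    by fact
  fix \<epsilon> :: real
  assume \<epsilon>: "\<epsilon> \<in> {0<..}" and "\<not> chi_q_tilde G \<le> Psi \<epsilon> G"
  \<comment> \<open>A real number strictly between the two values; once its slack matrix is
    certified, \<open>l\<close> belongs to the set whose supremum is
    \<open>Psi \<epsilon> G\<close>, a contradiction.\<close>
  then obtain l where l: "Psi \<epsilon> G < ereal l" "ereal l < chi_q_tilde G"
    using ereal_dense2[of "Psi \<epsilon> G" "chi_q_tilde G"] by (auto simp: not_le)
  obtain m y z where "dual_slack G l m y z \<in> sym_imats (indices G)"
    and "\<And>X. X \<in> cpsd (indices G) \<Longrightarrow> 0 \<le> imat_inner (indices G) (dual_slack G l m y z) X"
    using lower_bound_certificate[OF l(2)] by blast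
  then have "dual_slack G l m y z \<in> K_nc (indices G) \<epsilon>"
    using K_nc_of_cpsd_dual[OF assms(1) finite_indices[OF finite_verts]] \<epsilon> by simp
  then have "ereal l \<le> Psi \<epsilon> G"
    unfolding Psi_def by (intro Sup_upper) blast
  then show False
    using l(1) by simp
qed

end
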